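(* Let $f$ be a distortion element of $\mathrm{Diff}^1_0(\mathbb{S}^2)$ having at least three fixed points. Then for every fixed point $z$ of $f$, the derivative $Df(z)$ has $1$ as its unique eigenvalue.
   Context: $\mathrm{Diff}^1_0(\mathbb{S}^2)$ denotes the connected component of the identity in the group of $C^1$-diffeomorphisms of the 2-sphere $\mathbb{S}^2$. An element $f$ of a group $G$ is a distortion element if it has infinite order and there is a finite subset $S\subset G$ such that $f$ lies in the subgroup generated by $S$ and $\lim_{n\to\infty}|f^n|/n=0$, where $|f^n|$ is the word length of $f^n$ with respect to $S$. *)

theory Defs
  imports "HOL-Analysis.Analysis"
begin

type_synonym pt = "real^3"

definition S2 :: "pt set" where
  "S2 = sphere 0 1"

definition tangent :: "pt \<Rightarrow> pt set" where
  "tangent x = {v. v \<bullet> x = 0}"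

text \<open>Tangent derivative Df(x) of f at x in S2: any derivative of f within S2 at x,
  precomposed with the orthogonal projection onto the tangent plane (this is
  independent of the choice of the derivative).\<close>
definition tderiv :: "(pt \<Rightarrow> pt) \<Rightarrow> pt \<Rightarrow> pt \<Rightarrow> pt" where
  "tderiv f x = (SOME L. (f has_derivative L) (at x within S2)) \<circ> (\<lambda>v. v - (v \<bullet> x) *\<^sub>R x)"

definition C1_S2 :: "(pt \<Rightarrow> pt) \<Rightarrow> bool" where
  "C1_S2 f \<longleftrightarrow> (\<forall>x\<in>S2. \<exists>L. (f has_derivative L) (at x within S2)) \<and>
     (\<forall>x\<in>S2. \<forall>e>0. \<exists>d>0. \<forall>y\<in>S2. dist y x < d \<longrightarrow>
        onorm (\<lambda>v. tderiv f y v - tderiv f x v) < e)"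

text \<open>C^1 diffeomorphisms of S2, normalised to be the identity off S2 (so that
  composition is the group law and id the neutral element).\<close>
definition Diff1 :: "(pt \<Rightarrow> pt) set" where
  "Diff1 = {f. bij_betw f S2 S2 \<and> (\<forall>x. x \<notin> S2 \<longrightarrow> f x = x) \<and>
              C1_S2 f \<and> C1_S2 (inv_into S2 f)}"

definition c1dist :: "(pt \<Rightarrow> pt) \<Rightarrow> (pt \<Rightarrow> pt) \<Rightarrow> real" where
  "c1dist f g = (SUP x\<in>S2. norm (f x - g x)) +
                (SUP x\<in>S2. onorm (\<lambda>v. tderiv f x v - tderiv g x v))"

definition Diff1_top :: "(pt \<Rightarrow> pt) topology" where
  "Diff1_top = topology (\<lambda>U. U \<subseteq> Diff1 \<and>
     (\<forall>f\<in>U. \<exists>e>0. \<forall>g\<in>Diff1. c1dist f g < e \<longrightarrow> g \<in> U))"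

definition Diff1_0 :: "(pt \<Rightarrow> pt) set" where
  "Diff1_0 = connected_component_of_set Diff1_top id"

definition is_word :: "(pt \<Rightarrow> pt) set \<Rightarrow> (pt \<Rightarrow> pt) list \<Rightarrow> (pt \<Rightarrow> pt) \<Rightarrow> bool" where
  "is_word S xs g \<longleftrightarrow> set xs \<subseteq> S \<union> inv ` S \<and> g = foldr (\<circ>) xs id"

definition word_length :: "(pt \<Rightarrow> pt) set \<Rightarrow> (pt \<Rightarrow> pt) \<Rightarrow> nat" where
  "word_length S g = (LEAST k. \<exists>xs. length xs = k \<and> is_word S xs g)"

definition distortion :: "(pt \<Rightarrow> pt) \<Rightarrow> bool" where
  "distortion f \<longleftrightarrow> f \<in> Diff1_0 \<and> (\<forall>n>0. f ^^ n \<noteq> id) \<and>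
     (\<exists>S. finite S \<and> S \<subseteq> Diff1_0 \<and> (\<exists>xs. is_word S xs f) \<and>
        (\<lambda>n. real (word_length S (f ^^ n)) / real n) \<longlonglongrightarrow> 0)"

text \<open>mu (complex) is an eigenvalue of the real linear map L on the tangent plane at z,
  i.e. an eigenvalue of its complexification: L(u+iv) = mu (u+iv) with u+iv \<noteq> 0.\<close>
definition tan_eigenvalue :: "(pt \<Rightarrow> pt) \<Rightarrow> pt \<Rightarrow> complex \<Rightarrow> bool" where
  "tan_eigenvalue L z \<mu> \<longleftrightarrow> (\<exists>u v. u \<in> tangent z \<and> v \<in> tangent z \<and> (u \<noteq> 0 \<or> v \<noteq> 0) \<and>
      L u = Re \<mu> *\<^sub>R u - Im \<mu> *\<^sub>R v \<and> L v = Im \<mu> *\<^sub>R u + Re \<mu> *\<^sub>R v)"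

end

theory Submission
  imports Defs
begin

text \<open>
  Moving four points of the sphere by a diffeomorphism isotopic to the identity changes the argument
  of their cross-ratio by a real number, well defined because rotations preserve cross-ratios. For a
  \<open>C\<^sup>1\<close> diffeomorphism this number is bounded uniformly in the four points, and it is additive under
  composition, so for \<open>f\<^sup>n\<close> it is at most a constant times the word length, hence \<open>o(n)\<close>. Take the
  points to be three fixed points \<open>z\<close>, \<open>c\<close>, \<open>d\<close> and a point close to \<open>z\<close>: if \<open>Df(z)\<close> mapped no
  direction to itself, each iterate would turn the argument by a definite amount of constant sign and
  the growth would be linear. So \<open>Df(z)\<close> has an eigenvector with a nonnegative eigenvalue. The
  Lipschitz constants of \<open>f\<^sup>n\<close> and of its inverse grow subexponentially, so all eigenvalues have
  modulus 1, and \<open>Df(z)\<close> preserves orientation; thus both eigenvalues are 1.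
\<close>

text \<open>The obstacle is collision: an orbit stays near \<open>z\<close> for \<open>n\<close>
  steps only if it starts closer and closer to \<open>z\<close> as \<open>n\<close> grows, so the
  bound on the argument must survive when points merge. This is where C^1 closeness enters, through
  chords instead of points. For \<open>f ^^ n\<close> there are two lifts. The sum of the lift of
  \<open>f\<close> along an orbit shows the linear growth; the lift built from a short word in the
  generators has the small bound. They coincide because a lift is pinned down by continuity in one
  point and its value when two points agree. The identity component is used only through locally
  constant properties: having a lift, and preserving orientation. Spinors express the phase of the
  cross-ratio by a polynomial in vectors of R^3, with neither charts nor poles. It is affine in each
  point, so the study of directions at \<open>z\<close> is linear algebra.\<close>

section \<open>Spinors and cyclic products of projections\<close>

unbundle cross3_syntax

text \<open>Half the trace of \<open>(1 + p\<cdot>\<sigma>)(1 + q\<cdot>\<sigma>)(1 + r\<cdot>\<sigma>)(1 + s\<cdot>\<sigma>)\<close>, where \<open>\<sigma>\<close> are the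
  Pauli matrices: for unit vectors each factor is twice the projection onto a spinor.\<close>
definition bargmann :: "pt \<Rightarrow> pt \<Rightarrow> pt \<Rightarrow> pt \<Rightarrow> complex" where
  "bargmann p q r s = Complex ((1 + p \<bullet> q) * (1 + r \<bullet> s) + (p + q) \<bullet> (r + s) - (p \<times> q) \<bullet> (r \<times> s))
                        ((p + q) \<bullet> (r \<times> s) + (p \<times> q) \<bullet> (r + s))"

text \<open>Three of the four entries of the matrix identity
  \<open>1 + p\<cdot>\<sigma> = 2 \<psi> \<psi>*\<close>; the fourth is a conjugate. So
  \<open>\<psi>\<close> is a preimage of \<open>p\<close> under the Hopf map, determined only up to
  a phase.\<close>

definition spinor :: "pt \<Rightarrow> complex \<times> complex \<Rightarrow> bool" where
  "spinor p \<psi> \<longleftrightarrow> of_real (1 + p$3) = 2 * fst \<psi> * cnj (fst \<psi>) \<and>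
     Complex (p$1) (p$2) = 2 * snd \<psi> * cnj (fst \<psi>) \<and>
     of_real (1 - p$3) = 2 * snd \<psi> * cnj (snd \<psi>)"

definition hprod :: "complex \<times> complex \<Rightarrow> complex \<times> complex \<Rightarrow> complex" where
  "hprod \<phi> \<psi> = cnj (fst \<phi>) * fst \<psi> + cnj (snd \<phi>) * snd \<psi>"

lemma inner_real3: "(x :: real^3) \<bullet> y = x$1 * y$1 + x$2 * y$2 + x$3 * y$3"
  by (simp add: inner_vec_def sum_3)

lemma S2_components: "p \<in> S2 \<longleftrightarrow> (p$1)\<^sup>2 + (p$2)\<^sup>2 + (p$3)\<^sup>2 = 1"
  unfolding S2_def mem_sphere_0 norm_eq_1 by (simp add: inner_real3 power2_eq_square)

lemma ex_spinor:
  assumes "p \<in> S2"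
  shows "\<exists>\<psi>. spinor p \<psi>"
proof (cases "p$3 = -1")
  case True
  then have "p$1 = 0" "p$2 = 0"
    using assms by (auto simp: S2_components)
  with True show ?thesis
    by (intro exI[of _ "(0, 1)"]) (auto simp: spinor_def complex_eq_iff)
next
  case False
  have s: "(p$1)\<^sup>2 + (p$2)\<^sup>2 = (1 + p$3) * (1 - p$3)"
    using assms by (simp add: S2_components power2_eq_square algebra_simps)
  have "\<bar>p$3\<bar> \<le> 1"
    using assms component_le_norm_cart[of p 3] by (simp add: S2_def)
  with False have pos: "1 + p$3 > 0" by linarith
  \<comment> \<open>The free phase is used to make the first component real. The second is found by
    dividing by it, hence the separate case of the south pole.\<close>
  define t where "t = sqrt ((1 + p$3) / 2)"
  have t: "t * t = (1 + p$3) / 2" "t \<noteq> 0"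
    using pos by (auto simp: t_def)
  define y where "y = Complex (p$1) (p$2) / of_real (2 * t)"
  have "2 * y * cnj y = of_real (((p$1)\<^sup>2 + (p$2)\<^sup>2) / (2 * (t * t)))"
    using t(2) by (simp add: y_def complex_eq_iff field_simps power2_eq_square)
  also have "((p$1)\<^sup>2 + (p$2)\<^sup>2) / (2 * (t * t)) = 1 - p$3"
    using pos unfolding s t by (simp add: field_simps)
  finally have 1: "of_real (1 - p$3) = 2 * y * cnj y" by simp
  have 2: "Complex (p$1) (p$2) = 2 * y * cnj (of_real t)"
    using t(2) by (simp add: y_def)
  have 3: "of_real (1 + p$3) = 2 * of_real t * cnj (of_real t :: complex)"
    using t(1) by (simp add: complex_eq_iff)
  show ?thesis
    using 1 2 3 by (intro exI[of _ "(of_real t, y)"]) (simp add: spinor_def)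
qed

text \<open>The four entries of \<open>(1 + p\<cdot>\<sigma>)(1 + q\<cdot>\<sigma>)\<close>: the
  Pauli product rule gives the left sides, the rank-one form of both factors the right
  sides.\<close>

lemma spinor_pair:
  assumes "spinor p \<phi>" "spinor q \<psi>"
  shows "Complex (1 + p \<bullet> q + (p + q)$3) ((p \<times> q)$3) = 4 * hprod \<phi> \<psi> * (fst \<phi> * cnj (fst \<psi>))"
    "Complex ((p + q)$1 + (p \<times> q)$2) ((p \<times> q)$1 - (p + q)$2) = 4 * hprod \<phi> \<psi> * (fst \<phi> * cnj (snd \<psi>))"
    "Complex ((p + q)$1 - (p \<times> q)$2) ((p \<times> q)$1 + (p + q)$2) = 4 * hprod \<phi> \<psi> * (snd \<phi> * cnj (fst \<psi>))"
    "Complex (1 + p \<bullet> q - (p + q)$3) (- (p \<times> q)$3) = 4 * hprod \<phi> \<psi> * (snd \<phi> * cnj (snd \<psi>))"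
proof -
  obtain a b where [simp]: "\<phi> = (a, b)" by (cases \<phi>)
  obtain c d where [simp]: "\<psi> = (c, d)" by (cases \<psi>)
  have p: "of_real (1 + p$3) = 2 * a * cnj a" "Complex (p$1) (p$2) = 2 * b * cnj a"
      "of_real (1 - p$3) = 2 * b * cnj b"
    using assms(1) unfolding spinor_def by simp_all
  have q: "of_real (1 + q$3) = 2 * c * cnj c" "Complex (q$1) (q$2) = 2 * d * cnj c"
      "of_real (1 - q$3) = 2 * d * cnj d"
    using assms(2) unfolding spinor_def by simp_all
  have conj: "Complex (p$1) (- p$2) = 2 * a * cnj b" "Complex (q$1) (- q$2) = 2 * c * cnj d"
    using arg_cong[of _ _ cnj, OF p(2)] arg_cong[of _ _ cnj, OF q(2)]
    by (auto simp: complex_cnj algebra_simps)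
  have e11: "Complex (1 + p \<bullet> q + (p + q)$3) ((p \<times> q)$3) =
      of_real (1 + p$3) * of_real (1 + q$3) + Complex (p$1) (- p$2) * Complex (q$1) (q$2)"
    and e12: "Complex ((p + q)$1 + (p \<times> q)$2) ((p \<times> q)$1 - (p + q)$2) =
      of_real (1 + p$3) * Complex (q$1) (- q$2) + Complex (p$1) (- p$2) * of_real (1 - q$3)"
    and e21: "Complex ((p + q)$1 - (p \<times> q)$2) ((p \<times> q)$1 + (p + q)$2) =
      Complex (p$1) (p$2) * of_real (1 + q$3) + of_real (1 - p$3) * Complex (q$1) (q$2)"
    and e22: "Complex (1 + p \<bullet> q - (p + q)$3) (- (p \<times> q)$3) =
      Complex (p$1) (p$2) * Complex (q$1) (- q$2) + of_real (1 - p$3) * of_real (1 - q$3)"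
    by (simp_all add: complex_eq_iff inner_real3 cross3_def vector_3 algebra_simps)
  show "Complex (1 + p \<bullet> q + (p + q)$3) ((p \<times> q)$3) = 4 * hprod \<phi> \<psi> * (fst \<phi> * cnj (fst \<psi>))"
    unfolding e11 p q conj by (simp add: hprod_def algebra_simps)
  show "Complex ((p + q)$1 + (p \<times> q)$2) ((p \<times> q)$1 - (p + q)$2) = 4 * hprod \<phi> \<psi> * (fst \<phi> * cnj (snd \<psi>))"
    unfolding e12 p q conj by (simp add: hprod_def algebra_simps)
  show "Complex ((p + q)$1 - (p \<times> q)$2) ((p \<times> q)$1 + (p + q)$2) = 4 * hprod \<phi> \<psi> * (snd \<phi> * cnj (fst \<psi>))"
    unfolding e21 p q conj by (simp add: hprod_def algebra_simps)
  show "Complex (1 + p \<bullet> q - (p + q)$3) (- (p \<times> q)$3) = 4 * hprod \<phi> \<psi> * (snd \<phi> * cnj (snd \<psi>))"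
    unfolding e22 p q conj by (simp add: hprod_def algebra_simps)
qed

text \<open>The trace of a product of rank-one matrices is the cyclic product of inner products,
  here with the factor \<open>2^4 / 2\<close>. Every spinor occurs once plain and once conjugated,
  so the choice of phases cancels.\<close>

lemma bargmann_spinor:
  assumes "spinor p \<phi>1" "spinor q \<phi>2" "spinor r \<phi>3" "spinor s \<phi>4"
  shows "bargmann p q r s = 8 * hprod \<phi>1 \<phi>2 * hprod \<phi>2 \<phi>3 * hprod \<phi>3 \<phi>4 * hprod \<phi>4 \<phi>1"
proof -
  \<comment> \<open>The trace of the product of two 2 by 2 matrices with Pauli coefficients
    \<open>a0\<close>, \<open>a + i c\<close> and \<open>b0\<close>, \<open>b + i d\<close>:
    coefficients on the left, matrix entries on the right.\<close>
  have *: "Complex (a0 * b0 + (a1*b1 + a2*b2 + a3*b3) - (c1*d1 + c2*d2 + c3*d3))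
        ((a1*d1 + a2*d2 + a3*d3) + (c1*b1 + c2*b2 + c3*b3)) * 2 =
      Complex (a0 + a3) c3 * Complex (b0 + b3) d3 +
      Complex (a1 + c2) (c1 - a2) * Complex (b1 - d2) (d1 + b2) +
      Complex (a1 - c2) (c1 + a2) * Complex (b1 + d2) (d1 - b2) +
      Complex (a0 - a3) (- c3) * Complex (b0 - b3) (- d3)"
    for a0 a1 a2 a3 b0 b1 b2 b3 c1 c2 c3 d1 d2 d3
    by (simp add: complex_eq_iff algebra_simps)
  have "bargmann p q r s * 2 =
      Complex (1 + p \<bullet> q + (p + q)$3) ((p \<times> q)$3) * Complex (1 + r \<bullet> s + (r + s)$3) ((r \<times> s)$3) +
      Complex ((p + q)$1 + (p \<times> q)$2) ((p \<times> q)$1 - (p + q)$2) *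
      Complex ((r + s)$1 - (r \<times> s)$2) ((r \<times> s)$1 + (r + s)$2) +
      Complex ((p + q)$1 - (p \<times> q)$2) ((p \<times> q)$1 + (p + q)$2) *
      Complex ((r + s)$1 + (r \<times> s)$2) ((r \<times> s)$1 - (r + s)$2) +
      Complex (1 + p \<bullet> q - (p + q)$3) (- (p \<times> q)$3) * Complex (1 + r \<bullet> s - (r + s)$3) (- (r \<times> s)$3)"
    unfolding bargmann_def inner_real3[of "p + q"] inner_real3[of "p \<times> q"] by (rule *)
  also have "\<dots> = (8 * hprod \<phi>1 \<phi>2 * hprod \<phi>2 \<phi>3 * hprod \<phi>3 \<phi>4 * hprod \<phi>4 \<phi>1) * 2"
    unfolding spinor_pair[OF assms(1,2)] spinor_pair[OF assms(3,4)]
    by (simp add: hprod_def algebra_simps)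
  finally show ?thesis by simp
qed

lemma cmod_hprod_spinor:
  assumes "spinor p \<phi>" "spinor q \<psi>"
  shows "(cmod (hprod \<phi> \<psi>))\<^sup>2 = (1 + p \<bullet> q) / 2"
proof -
  have "complex_of_real (2 * (1 + p \<bullet> q)) = Complex (1 + p \<bullet> q + (p + q)$3) ((p \<times> q)$3)
      + Complex (1 + p \<bullet> q - (p + q)$3) (- (p \<times> q)$3)"
    by (simp add: complex_eq_iff)
  also have "\<dots> = 4 * (hprod \<phi> \<psi> * cnj (hprod \<phi> \<psi>))"
    unfolding spinor_pair[OF assms] by (simp add: hprod_def algebra_simps)
  also have "\<dots> = complex_of_real (4 * (cmod (hprod \<phi> \<psi>))\<^sup>2)"
    unfolding complex_norm_square[symmetric] by simp
  finally show ?thesis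
    unfolding of_real_eq_iff by simp
qed

subsection \<open>The phase of the cross-ratio and its lifts\<close>

text \<open>Up to a positive factor, the cross-ratio \<open>(a - b)(c - d) / ((a - d)(c - b))\<close> in a (conjugate)
  stereographic coordinate. Unlike the cross-ratio it is polynomial, and only its phase is used.\<close>
definition cross_amp :: "pt \<Rightarrow> pt \<Rightarrow> pt \<Rightarrow> pt \<Rightarrow> complex" where
  "cross_amp a b c d = bargmann a (- b) c (- d)"

text \<open>The change of the factor \<open>a - b\<close> when \<open>(a, b)\<close> moves to \<open>(a', b')\<close>, with the spinors of
  \<open>a\<close> and \<open>b\<close> transported along geodesics.\<close>
definition link :: "pt \<Rightarrow> pt \<Rightarrow> pt \<Rightarrow> pt \<Rightarrow> complex" where
  "link a b a' b' = bargmann a' (- b') (- b) a"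

definition spin :: "pt \<Rightarrow> complex \<times> complex" where
  "spin p = (SOME \<psi>. spinor p \<psi>)"

lemma spinor_spin: "p \<in> S2 \<Longrightarrow> spinor p (spin p)"
  unfolding spin_def by (rule someI_ex) (rule ex_spinor)

lemma uminus_S2 [simp]: "- p \<in> S2 \<longleftrightarrow> p \<in> S2"
  by (simp add: S2_def)

lemma cnj_hprod: "cnj (hprod \<phi> \<psi>) = hprod \<psi> \<phi>"
  by (simp add: hprod_def mult.commute)

lemma inner_S2_self: "p \<in> S2 \<Longrightarrow> p \<bullet> p = 1"
  by (simp add: S2_def norm_eq_1)

lemma inner_S2: "p \<in> S2 \<Longrightarrow> q \<in> S2 \<Longrightarrow> 1 - p \<bullet> q = (norm (p - q))\<^sup>2 / 2"
  by (simp add: power2_norm_eq_inner inner_S2_self algebra_simps inner_commute)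

text \<open>Every second point is replaced by its antipode, so each of the four inner products has
  squared modulus \<open>(1 - x \<bullet> y) / 2\<close>. The formula shows where the amplitude
  vanishes and later proves that \<open>cross_lin\<close> is injective on the tangent plane.\<close>

lemma cross_amp_norm:
  assumes "a \<in> S2" "b \<in> S2" "c \<in> S2" "d \<in> S2"
  shows "(cmod (cross_amp a b c d))\<^sup>2 = 4 * (1 - a \<bullet> b) * (1 - b \<bullet> c) * (1 - c \<bullet> d) * (1 - d \<bullet> a)"
proof -
  have *: "64 * (t / 2) * (u / 2) * (v / 2) * (w / 2) = 4 * t * u * v * w" for t u v w :: real
    by simp
  note h = spinor_spin[of a] spinor_spin[of "-b"] spinor_spin[of c] spinor_spin[of "-d"]
  have "cross_amp a b c d = 8 * hprod (spin a) (spin (-b)) * hprod (spin (-b)) (spin c) *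
      hprod (spin c) (spin (-d)) * hprod (spin (-d)) (spin a)"
    unfolding cross_amp_def by (rule bargmann_spinor) (use h assms in auto)
  then have "(cmod (cross_amp a b c d))\<^sup>2 = 64 * (cmod (hprod (spin a) (spin (-b))))\<^sup>2 *
      (cmod (hprod (spin (-b)) (spin c)))\<^sup>2 * (cmod (hprod (spin c) (spin (-d))))\<^sup>2 *
      (cmod (hprod (spin (-d)) (spin a)))\<^sup>2"
    by (simp add: norm_mult power_mult_distrib)
  also have "\<dots> = 64 * ((1 + a \<bullet> (-b)) / 2) * ((1 + (-b) \<bullet> c) / 2) * ((1 + c \<bullet> (-d)) / 2) * ((1 + (-d) \<bullet> a) / 2)"
    using h assms by (simp add: cmod_hprod_spinor)
  finally show ?thesis
    unfolding inner_minus_left inner_minus_right add_uminus_conv_diff * .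
qed

text \<open>Only cyclic neighbours must differ: \<open>b = d\<close> has to be allowed because it
  normalises the lifts, and \<open>a = c\<close> does no harm.\<close>

definition quad :: "pt \<Rightarrow> pt \<Rightarrow> pt \<Rightarrow> pt \<Rightarrow> bool" where
  "quad a b c d \<longleftrightarrow> a \<in> S2 \<and> b \<in> S2 \<and> c \<in> S2 \<and> d \<in> S2 \<and> a \<noteq> b \<and> c \<noteq> b \<and> c \<noteq> d \<and> a \<noteq> d"

lemma cross_amp_nonzero: "quad a b c d \<Longrightarrow> cross_amp a b c d \<noteq> 0"
  using cross_amp_norm[of a b c d] by (auto simp: quad_def inner_S2)

text \<open>Each transport factor, such as \<open>hprod (spin a) (spin a')\<close>, occurs in two of
  the four links, once conjugated, and leaves only a squared modulus.\<close>

lemma link_product: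
  assumes "a \<in> S2" "b \<in> S2" "c \<in> S2" "d \<in> S2" "a' \<in> S2" "b' \<in> S2" "c' \<in> S2" "d' \<in> S2"
  obtains K where "K \<ge> 0"
    "link a b a' b' * cnj (link c b c' b') * link c d c' d' * cnj (link a d a' d')
      = of_real K * cross_amp a' b' c' d' * cnj (cross_amp a b c d)"
proof
  note sp = spinor_spin[of a] spinor_spin[of "-b"] spinor_spin[of c] spinor_spin[of "-d"]
    spinor_spin[of a'] spinor_spin[of "-b'"] spinor_spin[of c'] spinor_spin[of "-d'"]
  define K where "K = 64 * ((cmod (hprod (spin (-b)) (spin (-b'))))\<^sup>2 * (cmod (hprod (spin a) (spin a')))\<^sup>2 *
    (cmod (hprod (spin c) (spin c')))\<^sup>2 * (cmod (hprod (spin (-d)) (spin (-d'))))\<^sup>2)"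
  show "K \<ge> 0" by (simp add: K_def)
  have K: "complex_of_real K = 64 *
     ((hprod (spin (-b)) (spin (-b')) * hprod (spin (-b')) (spin (-b))) *
      (hprod (spin a) (spin a') * hprod (spin a') (spin a)) *
      (hprod (spin c) (spin c') * hprod (spin c') (spin c)) *
      (hprod (spin (-d)) (spin (-d')) * hprod (spin (-d')) (spin (-d))))"
    unfolding K_def of_real_mult complex_norm_square cnj_hprod of_real_numeral by (rule refl)
  show "link a b a' b' * cnj (link c b c' b') * link c d c' d' * cnj (link a d a' d')
      = of_real K * cross_amp a' b' c' d' * cnj (cross_amp a b c d)"
    unfolding link_def cross_amp_def K
    using sp assms
    by (simp add: bargmann_spinor[of _ "spin _" _ "spin _" _ "spin _" _ "spin _"] cnj_hprod mult_ac)
qed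

text \<open>The normalisation \<open>\<Theta> a d c d = 0\<close> makes sense because the cross-ratio equals 1 when
  \<open>b = d\<close>; it singles out one lift, so that no isotopy has to be remembered.\<close>
definition is_lift :: "(pt \<Rightarrow> pt) \<Rightarrow> (pt \<Rightarrow> pt \<Rightarrow> pt \<Rightarrow> pt \<Rightarrow> real) \<Rightarrow> real \<Rightarrow> bool" where
  "is_lift g \<Theta> C \<longleftrightarrow> bij_betw g S2 S2 \<and> continuous_on S2 g \<and>
     (\<forall>a b c d. quad a b c d \<longrightarrow>
        sgn (cross_amp (g a) (g b) (g c) (g d)) = cis (\<Theta> a b c d) * sgn (cross_amp a b c d) \<and> \<bar>\<Theta> a b c d\<bar> \<le> C) \<and>
     (\<forall>a c d. quad a d c d \<longrightarrow> \<Theta> a d c d = 0 \<and> continuous_on (S2 - {a, c}) (\<lambda>b. \<Theta> a b c d))"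

lemma quad_image:
  assumes "bij_betw g S2 S2" "quad a b c d"
  shows "quad (g a) (g b) (g c) (g d)"
  using assms by (auto simp: quad_def bij_betw_def inj_on_def)

text \<open>The cocycle rule. Since the bounds add as well, lifts of words are controlled by word
  length.\<close>

lemma is_lift_compose:
  assumes g: "is_lift g \<Theta> C" and h: "is_lift h \<Theta>' C'"
  shows "is_lift (g \<circ> h) (\<lambda>a b c d. \<Theta>' a b c d + \<Theta> (h a) (h b) (h c) (h d)) (C + C')"
proof -
  have bg: "bij_betw g S2 S2" and bh: "bij_betw h S2 S2"
    and cg: "continuous_on S2 g" and ch: "continuous_on S2 h"
    using g h by (auto simp: is_lift_def)
  note q = quad_image[OF bh]
  have im: "h ` (S2 - {a, c}) \<subseteq> S2 - {h a, h c}" if "a \<in> S2" "c \<in> S2" for a c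
    using bh that by (auto simp: bij_betw_def inj_on_def)
  show ?thesis
    unfolding is_lift_def
  proof (intro conjI allI impI)
    show "bij_betw (g \<circ> h) S2 S2" using bij_betw_trans[OF bh bg] .
    show "continuous_on S2 (g \<circ> h)"
      using bh by (intro continuous_on_compose ch) (simp add: bij_betw_def cg)
  next
    fix a b c d assume qd: "quad a b c d"
    have "\<bar>\<Theta>' a b c d\<bar> \<le> C'" "\<bar>\<Theta> (h a) (h b) (h c) (h d)\<bar> \<le> C"
      using g h qd q[OF qd] unfolding is_lift_def by blast+
    then show "\<bar>\<Theta>' a b c d + \<Theta> (h a) (h b) (h c) (h d)\<bar> \<le> C + C'" by linarith
    have 1: "sgn (cross_amp (h a) (h b) (h c) (h d)) = cis (\<Theta>' a b c d) * sgn (cross_amp a b c d)"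
      using h qd unfolding is_lift_def by blast
    have 2: "sgn (cross_amp (g (h a)) (g (h b)) (g (h c)) (g (h d))) =
        cis (\<Theta> (h a) (h b) (h c) (h d)) * sgn (cross_amp (h a) (h b) (h c) (h d))"
      using g q[OF qd] unfolding is_lift_def by blast
    show "sgn (cross_amp ((g \<circ> h) a) ((g \<circ> h) b) ((g \<circ> h) c) ((g \<circ> h) d)) =
        cis (\<Theta>' a b c d + \<Theta> (h a) (h b) (h c) (h d)) * sgn (cross_amp a b c d)"
      using 1 2 by (simp add: cis_mult[symmetric] mult_ac)
  next
    fix a c d assume qd: "quad a d c d"
    have "\<Theta>' a d c d = 0" "\<Theta> (h a) (h d) (h c) (h d) = 0"
      using g h qd q[OF qd] unfolding is_lift_def by blast+
    then show "\<Theta>' a d c d + \<Theta> (h a) (h d) (h c) (h d) = 0" by simp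
    have S: "a \<in> S2" "c \<in> S2" using qd by (auto simp: quad_def)
    have 1: "continuous_on (S2 - {a, c}) (\<lambda>b. \<Theta>' a b c d)"
      using h qd unfolding is_lift_def by blast
    have 2: "continuous_on (S2 - {h a, h c}) (\<lambda>b. \<Theta> (h a) b (h c) (h d))"
      using g q[OF qd] unfolding is_lift_def by blast
    have "continuous_on (S2 - {a, c}) (\<lambda>b. \<Theta> (h a) (h b) (h c) (h d))"
      by (rule continuous_on_compose2[OF 2 continuous_on_subset[OF ch] im[OF S]]) auto
    with 1 show "continuous_on (S2 - {a, c}) (\<lambda>b. \<Theta>' a b c d + \<Theta> (h a) (h b) (h c) (h d))"
      by (intro continuous_intros)
  qed
qed

text \<open>The cocycle rule for \<open>g \<circ> h = id\<close> on the sphere; the constant does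
  not change.\<close>

lemma is_lift_inverse:
  assumes g: "is_lift g \<Theta> C" and bh: "bij_betw h S2 S2" and ch: "continuous_on S2 h"
    and gh: "\<And>x. x \<in> S2 \<Longrightarrow> g (h x) = x"
  shows "is_lift h (\<lambda>a b c d. - \<Theta> (h a) (h b) (h c) (h d)) C"
proof -
  note q = quad_image[OF bh]
  have im: "h ` (S2 - {a, c}) \<subseteq> S2 - {h a, h c}" if "a \<in> S2" "c \<in> S2" for a c
    using bh that by (auto simp: bij_betw_def inj_on_def)
  show ?thesis
    unfolding is_lift_def
  proof (intro conjI allI impI bh ch)
    fix a b c d assume qd: "quad a b c d"
    show "\<bar>- \<Theta> (h a) (h b) (h c) (h d)\<bar> \<le> C"
      using g q[OF qd] unfolding is_lift_def by simp
    have "sgn (cross_amp (g (h a)) (g (h b)) (g (h c)) (g (h d))) =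
        cis (\<Theta> (h a) (h b) (h c) (h d)) * sgn (cross_amp (h a) (h b) (h c) (h d))"
      using g q[OF qd] unfolding is_lift_def by blast
    then have "sgn (cross_amp a b c d) = cis (\<Theta> (h a) (h b) (h c) (h d)) * sgn (cross_amp (h a) (h b) (h c) (h d))"
      using qd by (simp add: quad_def gh)
    then show "sgn (cross_amp (h a) (h b) (h c) (h d)) =
        cis (- \<Theta> (h a) (h b) (h c) (h d)) * sgn (cross_amp a b c d)"
      by (simp add: mult.assoc[symmetric] cis_mult)
  next
    fix a c d assume qd: "quad a d c d"
    show "- \<Theta> (h a) (h d) (h c) (h d) = 0"
      using g q[OF qd] unfolding is_lift_def by simp
    have S: "a \<in> S2" "c \<in> S2" using qd by (auto simp: quad_def)
    have 2: "continuous_on (S2 - {h a, h c}) (\<lambda>b. \<Theta> (h a) b (h c) (h d))"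
      using g q[OF qd] unfolding is_lift_def by blast
    have "continuous_on (S2 - {a, c}) (\<lambda>b. \<Theta> (h a) (h b) (h c) (h d))"
      by (rule continuous_on_compose2[OF 2 continuous_on_subset[OF ch] im[OF S]]) auto
    then show "continuous_on (S2 - {a, c}) (\<lambda>b. - \<Theta> (h a) (h b) (h c) (h d))"
      by (intro continuous_intros)
  qed
qed

lemma is_lift_id: "is_lift id (\<lambda>_ _ _ _. 0) 0"
  by (simp add: is_lift_def)

text \<open>Removing \<open>a\<close> leaves a plane, which stays connected when at most one more
  point is removed. The point \<open>c\<close> may equal \<open>a\<close>, as \<open>quad\<close>
  permits.\<close>

lemma connected_S2_minus_two:
  assumes "a \<in> S2"
  shows "connected (S2 - {a, c})"
proof -
  obtain b :: pt where "norm b = 1" using vector_choose_size[of 1] by auto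
  then have b: "b \<noteq> 0" by auto
  with homeomorphic_punctured_sphere_hyperplane[of 1 a 0 b 0] assms
  have "(S2 - {a}) homeomorphic {x. b \<bullet> x = 0}" by (simp add: S2_def)
  then obtain f g where fg: "homeomorphism (S2 - {a}) {x. b \<bullet> x = 0} f g"
    unfolding homeomorphic_def by blast
  define H where "H = (if c \<in> S2 - {a} then {x. b \<bullet> x = 0} - {f c} else {x. b \<bullet> x = 0})"
  have "connected ({x. b \<bullet> x = 0} - {f c})"
    by (intro path_connected_imp_connected path_connected_punctured_convex convex_hyperplane)
       (simp add: aff_dim_hyperplane b)
  then have "connected H"
    by (simp add: H_def convex_connected convex_hyperplane)
  moreover have "continuous_on H g"
    using fg by (auto simp: homeomorphism_def H_def intro: continuous_on_subset)
  ultimately have "connected (g ` H)"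
    by (rule connected_continuous_image[rotated])
  moreover have "g ` H = S2 - {a, c}"
  proof (cases "c \<in> S2 - {a}")
    case True
    then have "inj_on g {x. b \<bullet> x = 0}" "g ` {x. b \<bullet> x = 0} = S2 - {a}" "g (f c) = c"
        "f c \<in> {x. b \<bullet> x = 0}"
      using fg by (auto simp: homeomorphism_def intro: inj_on_inverseI)
    then have "g ` ({x. b \<bullet> x = 0} - {f c}) = S2 - {a} - {c}"
      using inj_on_image_set_diff[of g "{x. b \<bullet> x = 0}" "{x. b \<bullet> x = 0}" "{f c}"] by simp
    then show ?thesis
      using True by (auto simp: H_def)
  next
    case False
    then show ?thesis using fg by (auto simp: H_def homeomorphism_def)
  qed
  ultimately show ?thesis by simp
qed

text \<open>Divided by 2 pi, the difference of two lifts is an integer-valued continuous function of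
  the second point on a connected set, and it vanishes when that point is \<open>d\<close>.\<close>

lemma is_lift_unique:
  assumes g: "is_lift g \<Theta> C" and h: "is_lift h \<Theta>' C'" and eq: "\<And>x. x \<in> S2 \<Longrightarrow> g x = h x"
    and q: "quad a b c d"
  shows "\<Theta> a b c d = \<Theta>' a b c d"
proof -
  have S: "a \<in> S2" "b \<in> S2 - {a, c}" "d \<in> S2 - {a, c}" "c \<in> S2"
    using q by (auto simp: quad_def)
  have qd: "quad a x c d" if "x \<in> S2 - {a, c}" for x
    using q that by (auto simp: quad_def)
  define F where "F x = (\<Theta> a x c d - \<Theta>' a x c d) / (2 * pi)" for x
  have z: "\<Theta> a d c d = 0" "\<Theta>' a d c d = 0"
    and cont: "continuous_on (S2 - {a, c}) (\<lambda>x. \<Theta> a x c d)"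
      "continuous_on (S2 - {a, c}) (\<lambda>x. \<Theta>' a x c d)"
    using g h qd[OF S(3)] unfolding is_lift_def by blast+
  have contF: "continuous_on (S2 - {a, c}) F"
    unfolding F_def by (intro continuous_intros cont) simp
  have int: "F x \<in> \<int>" if x: "x \<in> S2 - {a, c}" for x
  proof -
    have e1: "sgn (cross_amp (g a) (g x) (g c) (g d)) = cis (\<Theta> a x c d) * sgn (cross_amp a x c d)"
      using g qd[OF x] unfolding is_lift_def by blast
    have e2: "sgn (cross_amp (h a) (h x) (h c) (h d)) = cis (\<Theta>' a x c d) * sgn (cross_amp a x c d)"
      using h qd[OF x] unfolding is_lift_def by blast
    have "cis (\<Theta> a x c d) * sgn (cross_amp a x c d) = cis (\<Theta>' a x c d) * sgn (cross_amp a x c d)"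
      by (rule box_equals[OF _ e1 e2]) (use eq[of a] eq[of x] eq[of c] eq[of d] S x in simp)
    then have "cis (\<Theta> a x c d) = cis (\<Theta>' a x c d)"
      using cross_amp_nonzero[OF qd[OF x]] by (simp add: sgn_zero_iff)
    then have "cis (\<Theta> a x c d - \<Theta>' a x c d) = 1"
      unfolding cis_divide[symmetric] by simp
    then have "cos (\<Theta> a x c d - \<Theta>' a x c d) = 1"
      by (simp add: complex_eq_iff)
    then obtain n :: int where "\<Theta> a x c d - \<Theta>' a x c d = of_int n * 2 * pi"
      unfolding cos_one_2pi_int by blast
    then show ?thesis by (simp add: F_def)
  qed
  have "F constant_on (S2 - {a, c})"
  proof (rule continuous_discrete_range_constant[OF connected_S2_minus_two[OF S(1)]])
    show "continuous_on (S2 - {a, c}) F" by (rule contF)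
    fix x assume x: "x \<in> S2 - {a, c}"
    show "\<exists>e>0. \<forall>y. y \<in> S2 - {a, c} \<and> F y \<noteq> F x \<longrightarrow> e \<le> norm (F y - F x)"
    proof (intro exI[of _ 1] conjI allI impI)
      fix y assume y: "y \<in> S2 - {a, c} \<and> F y \<noteq> F x"
      then have "F y - F x \<in> \<int>" using int[of y] int[OF x] by (simp add: Ints_diff)
      then show "1 \<le> norm (F y - F x)"
        using y Ints_nonzero_abs_ge1[of "F y - F x"] by simp
    qed simp
  qed
  then have "F b = F d" using S by (auto simp: constant_on_def)
  moreover have "F d = 0"
    by (simp add: F_def z)
  ultimately show ?thesis by (simp add: F_def)
qed

section \<open>Lifts of maps close to the identity\<close>

text \<open>With chords \<open>c = b - a\<close> and \<open>c' = b' - a'\<close>, the main term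
  \<open>(1 + a \<bullet> a') * (c \<bullet> c')\<close> is at least 1.79 times \<open>|c|^2\<close>
  and the errors are at most 0.22 times \<open>|c|^2\<close>. Both are quadratic in the chord, so
  positivity persists however close \<open>a\<close> and \<open>b\<close> are.\<close>

lemma Re_link_pos:
  assumes S: "a \<in> S2" "b \<in> S2" "a' \<in> S2" "b' \<in> S2"
    and "a \<noteq> b" "norm (a' - a) \<le> 1/10" and e: "norm ((b' - a') - (b - a)) \<le> norm (b - a) / 10"
  shows "Re (link a b a' b') > 0"
proof -
  define c where "c = b - a"
  define c' where "c' = b' - a'"
  define e where "e = c' - c"
  define n where "n = norm c"
  have n: "n > 0" using assms by (simp add: n_def c_def)
  have ne: "norm e \<le> n / 10" using e by (simp add: e_def c_def c'_def n_def)
  note u = inner_S2_self[OF S(1)] inner_S2_self[OF S(2)] inner_S2_self[OF S(3)] inner_S2_self[OF S(4)]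
  have b: "b = a + c" "b' = a' + c'" "c' = c + e" by (auto simp: c_def c'_def e_def)
  have n2: "n \<le> 2"
    using norm_triangle_ineq4[of b a] S by (simp add: n_def c_def S2_def)
  have n'2: "norm c' \<le> 2"
    using norm_triangle_ineq4[of b' a'] S by (simp add: c'_def S2_def)
  have n': "norm c' \<le> n * 11 / 10"
    using norm_triangle_ineq[of c e] ne b(3) by (simp add: n_def)
  have cc: "c \<bullet> c = n\<^sup>2" by (simp add: n_def power2_norm_eq_inner)
  have ac: "a \<bullet> c = - (n\<^sup>2) / 2"
    using u(2) unfolding b by (simp add: u cc algebra_simps inner_commute)
  have ac': "a' \<bullet> c' = - ((norm c')\<^sup>2) / 2"
    using u(4) unfolding b(2) by (simp add: u power2_norm_eq_inner algebra_simps inner_commute)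
  have aa': "a \<bullet> a' \<ge> 99/100"
  proof -
    have "(norm (a' - a))\<^sup>2 \<le> (1/10)\<^sup>2" using assms(6) by (intro power_mono) auto
    with inner_S2[OF S(3,1)] show ?thesis by (simp add: inner_commute power2_eq_square)
  qed
  have "\<bar>c \<bullet> e\<bar> \<le> n * (n/10)"
    using Cauchy_Schwarz_ineq2[of c e] mult_left_mono[OF ne less_imp_le[OF n]]
    unfolding n_def[symmetric] by linarith
  then have ce: "c \<bullet> c' \<ge> n\<^sup>2 * (9/10)"
    using cc b(3) by (simp add: inner_add_right power2_eq_square)
  have ae: "\<bar>a \<bullet> e\<bar> \<le> n/10" "\<bar>a' \<bullet> e\<bar> \<le> n/10"
    using Cauchy_Schwarz_ineq2[of a e] Cauchy_Schwarz_ineq2[of a' e] ne S by (auto simp: S2_def)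
  \<comment> \<open>After Lagrange's identity for the cross products, unit length expresses
    \<open>a \<bullet> c\<close> and \<open>a' \<bullet> c'\<close> by squared chords, and the two
    quartic terms \<open>n^2 |c'|^2 / 4\<close> cancel.\<close>
  have Re: "Re (link a b a' b') = (1 + a \<bullet> a') * (c \<bullet> c') - n\<^sup>2 * (a' \<bullet> e) / 2
      + (a \<bullet> e) * (norm c')\<^sup>2 / 2 + (a \<bullet> e) * (a' \<bullet> e)"
  proof -
    have "Re (link a b a' b') = (1 - a' \<bullet> b') * (1 - a \<bullet> b) + c \<bullet> c' + (a \<times> b) \<bullet> (a' \<times> b')"
      by (simp add: link_def bargmann_def c_def c'_def inner_commute cross_minus_left cross_minus_right
          algebra_simps cross_skew[of b a])
    also have "(a \<times> b) \<bullet> (a' \<times> b') = (a \<times> c) \<bullet> (a' \<times> c')"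
      by (simp add: b cross_add_right)
    also have "\<dots> = (a \<bullet> a') * (c \<bullet> c') - (a \<bullet> c') * (a' \<bullet> c)"
      by (simp add: dot_cross inner_commute)
    also have "a \<bullet> c' = - (n\<^sup>2) / 2 + a \<bullet> e" using ac by (simp add: b(3) inner_add_right)
    also have "a' \<bullet> c = - ((norm c')\<^sup>2) / 2 - a' \<bullet> e" using ac' by (simp add: b(3) inner_add_right)
    also have "1 - a' \<bullet> b' = (norm c')\<^sup>2 / 2"
      using inner_S2[OF S(3,4)] by (simp add: c'_def norm_minus_commute)
    also have "1 - a \<bullet> b = n\<^sup>2 / 2"
      using inner_S2[OF S(1,2)] by (simp add: c_def n_def norm_minus_commute)
    finally show ?thesis by (simp add: algebra_simps)
  qed
  have 1: "(1 + a \<bullet> a') * (c \<bullet> c') \<ge> (199/100) * (n\<^sup>2 * (9/10))"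
    using aa' ce by (intro mult_mono) auto
  have 2: "n\<^sup>2 * (a' \<bullet> e) / 2 \<le> n\<^sup>2 * (1/10)"
  proof -
    have "a' \<bullet> e \<le> 2/10" using ae n2 by linarith
    then have "n\<^sup>2 * (a' \<bullet> e) \<le> n\<^sup>2 * (2/10)" by (intro mult_left_mono) auto
    then show ?thesis by linarith
  qed
  have 3: "(a \<bullet> e) * (norm c')\<^sup>2 / 2 \<ge> - (n\<^sup>2 * (11/100))"
  proof -
    have "(norm c')\<^sup>2 \<le> (n * 11 / 10) * 2"
      unfolding power2_eq_square using n' n'2 n by (intro mult_mono) auto
    then have "\<bar>a \<bullet> e\<bar> * (norm c')\<^sup>2 \<le> (n/10) * ((n * 11 / 10) * 2)"
      using ae n by (intro mult_mono) auto
    moreover have "- (\<bar>a \<bullet> e\<bar> * (norm c')\<^sup>2) \<le> (a \<bullet> e) * (norm c')\<^sup>2"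
      by (metis abs_le_D2 abs_mult abs_of_nonneg minus_le_iff order_refl zero_le_power2)
    ultimately show ?thesis by (simp add: power2_eq_square)
  qed
  have 4: "(a \<bullet> e) * (a' \<bullet> e) \<ge> - (n\<^sup>2 * (1/100))"
  proof -
    have "\<bar>(a \<bullet> e) * (a' \<bullet> e)\<bar> \<le> (n/10) * (n/10)"
      unfolding abs_mult using ae n by (intro mult_mono) auto
    then show ?thesis by (simp add: power2_eq_square abs_le_iff)
  qed
  have "n\<^sup>2 > 0" using n by simp
  with 1 2 3 4 show ?thesis unfolding Re by linarith
qed

text \<open>All links lie in the right half-plane, where the principal argument is continuous. The
  alternating sum of the four arguments vanishes for \<open>b = d\<close> and is at most
  \<open>4 * pi\<close> in absolute value.\<close>

lemma is_lift_near_identity: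
  assumes bk: "bij_betw k S2 S2" and near: "\<And>x. x \<in> S2 \<Longrightarrow> norm (k x - x) \<le> 1/10"
    and lip: "\<And>x y. x \<in> S2 \<Longrightarrow> y \<in> S2 \<Longrightarrow> norm ((k x - k y) - (x - y)) \<le> norm (x - y) / 10"
  shows "\<exists>\<Theta> C. is_lift k \<Theta> C"
proof -
  define \<theta> where "\<theta> a b = Arg (link a b (k a) (k b))" for a b
  define \<Theta> where "\<Theta> a b c d = \<theta> a b - \<theta> c b + \<theta> c d - \<theta> a d" for a b c d
  have kS: "k x \<in> S2" if "x \<in> S2" for x using bk that by (auto simp: bij_betw_def)
  have pos: "Re (link a b (k a) (k b)) > 0" if "a \<in> S2" "b \<in> S2" "a \<noteq> b" for a b
    using that kS near lip by (intro Re_link_pos) auto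
  have ck: "continuous_on S2 k"
  proof (rule continuous_on_eq)
    have "continuous_on S2 (\<lambda>x. k x - x)"
    proof (rule lipschitz_on_continuous_on)
      show "(1/10)-lipschitz_on S2 (\<lambda>x. k x - x)"
        using lip by (intro lipschitz_onI) (simp_all add: dist_norm algebra_simps)
    qed
    then show "continuous_on S2 (\<lambda>x. (k x - x) + x)"
      by (rule continuous_on_add) (rule continuous_on_id)
  qed simp
  have cont: "continuous_on (S2 - {a}) (\<theta> a)" if a: "a \<in> S2" for a
  proof -
    have ck': "continuous_on (S2 - {a}) k" by (rule continuous_on_subset[OF ck]) auto
    have cl: "continuous_on (S2 - {a}) (\<lambda>b. link a b (k a) (k b))"
      unfolding link_def bargmann_def Complex_eq
      by (intro continuous_intros continuous_on_cross ck')
    have "continuous_on {z. Re z > 0} Arg"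
      by (intro continuous_at_imp_continuous_on ballI continuous_at_Arg)
         (auto simp: complex_nonpos_Reals_iff)
    then show ?thesis
      unfolding \<theta>_def by (rule continuous_on_compose2[OF _ cl]) (use a pos in auto)
  qed
  have bnd: "\<bar>\<theta> a b\<bar> \<le> pi" for a b
    using Arg_bounded[of "link a b (k a) (k b)"] by (auto simp: \<theta>_def)
  have sgnA: "sgn (link a b (k a) (k b)) = cis (\<theta> a b)" if "a \<in> S2" "b \<in> S2" "a \<noteq> b" for a b
  proof -
    have "link a b (k a) (k b) \<noteq> 0" using pos[OF that] by auto
    then show ?thesis by (simp add: \<theta>_def cis_Arg)
  qed
  have "is_lift k \<Theta> (4 * pi)"
    unfolding is_lift_def
  proof (intro conjI allI impI bk ck)
    fix a b c d assume q: "quad a b c d"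
    then have S: "a \<in> S2" "b \<in> S2" "c \<in> S2" "d \<in> S2" "a \<noteq> b" "c \<noteq> b" "c \<noteq> d" "a \<noteq> d"
      by (auto simp: quad_def)
    show "\<bar>\<Theta> a b c d\<bar> \<le> 4 * pi"
      using bnd[of a b] bnd[of c b] bnd[of c d] bnd[of a d] unfolding \<Theta>_def by linarith
    obtain K where K: "K \<ge> 0" "link a b (k a) (k b) * cnj (link c b (k c) (k b)) * link c d (k c) (k d) *
        cnj (link a d (k a) (k d)) = of_real K * cross_amp (k a) (k b) (k c) (k d) * cnj (cross_amp a b c d)"
      using link_product[OF S(1-4) S(1-4)[THEN kS]] by blast
    have "link a b (k a) (k b) * cnj (link c b (k c) (k b)) * link c d (k c) (k d) *
        cnj (link a d (k a) (k d)) \<noteq> 0"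
      using pos[OF S(1,2,5)] pos[OF S(3,2,6)] pos[OF S(3,4,7)] pos[OF S(1,4,8)] by auto
    then have K0: "K > 0" using K by (cases "K = 0") auto
    have cs: "sgn (cnj z) = cnj (sgn z)" for z by (simp add: sgn_eq)
    have "cis (\<Theta> a b c d) = cis (\<theta> a b) * cnj (cis (\<theta> c b)) * cis (\<theta> c d) * cnj (cis (\<theta> a d))"
      by (simp add: \<Theta>_def cis_cnj cis_mult algebra_simps)
    also have "\<dots> = sgn (link a b (k a) (k b) * cnj (link c b (k c) (k b)) * link c d (k c) (k d) *
        cnj (link a d (k a) (k d)))"
      by (simp add: sgn_mult cs sgnA S)
    also have "\<dots> = sgn (cross_amp (k a) (k b) (k c) (k d)) * cnj (sgn (cross_amp a b c d))"
      unfolding K(2) using K0 by (simp add: sgn_mult cs sgn_of_real)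
    finally have "cis (\<Theta> a b c d) * sgn (cross_amp a b c d) =
        sgn (cross_amp (k a) (k b) (k c) (k d)) * (sgn (cross_amp a b c d) * cnj (sgn (cross_amp a b c d)))"
      by (simp add: mult_ac)
    also have "sgn (cross_amp a b c d) * cnj (sgn (cross_amp a b c d)) = 1"
      using cross_amp_nonzero[OF q] by (simp add: complex_norm_square[symmetric] norm_sgn)
    finally show "sgn (cross_amp (k a) (k b) (k c) (k d)) = cis (\<Theta> a b c d) * sgn (cross_amp a b c d)"
      by simp
  next
    fix a c d assume q: "quad a d c d"
    then have S: "a \<in> S2" "c \<in> S2" by (auto simp: quad_def)
    show "\<Theta> a d c d = 0" by (simp add: \<Theta>_def)
    show "continuous_on (S2 - {a, c}) (\<lambda>b. \<Theta> a b c d)"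
      unfolding \<Theta>_def
      by (intro continuous_intros continuous_on_subset[OF cont[OF S(1)]] continuous_on_subset[OF cont[OF S(2)]]) auto
  qed
  then show ?thesis by blast
qed

subsection \<open>Derivatives on the sphere\<close>

text \<open>A derivative within the sphere is arbitrary in the normal direction. Composing with
  curves on the sphere reduces to derivatives in one real variable, which are unique.\<close>

lemma has_vector_derivative_along_curve:
  assumes F: "(F has_derivative L) (at (\<gamma> t) within S2)"
    and \<gamma>: "\<And>s. \<gamma> s \<in> S2" "(\<gamma> has_vector_derivative v) (at t)"
  shows "((\<lambda>s. F (\<gamma> s)) has_vector_derivative L v) (at t)"
proof -
  have "(F has_derivative L) (at (\<gamma> t) within range \<gamma>)"
    by (rule has_derivative_subset[OF F]) (use \<gamma> in auto)
  then have "((\<lambda>s. F (\<gamma> s)) has_derivative (\<lambda>s. L (s *\<^sub>R v))) (at t)"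
    using \<gamma>(2) unfolding has_vector_derivative_def by (rule has_derivative_in_compose[rotated])
  then show ?thesis
    unfolding has_vector_derivative_def
    using linear_scale[OF has_derivative_linear[OF F]] by simp
qed

text \<open>A great circle run at speed \<open>norm v\<close>; for \<open>v = 0\<close> the
  convention \<open>sgn 0 = 0\<close> makes it constant.\<close>

lemma ex_curve:
  assumes "x \<in> S2" "v \<in> tangent x"
  obtains \<gamma> where "\<gamma> (0::real) = x" "\<And>t. \<gamma> t \<in> S2" "(\<gamma> has_vector_derivative v) (at 0)"
proof
  let ?\<gamma> = "\<lambda>t. cos (norm v * t) *\<^sub>R x + sin (norm v * t) *\<^sub>R sgn v"
  show "?\<gamma> 0 = x" by simp
  have "x \<bullet> sgn v = 0"
    using assms by (simp add: tangent_def sgn_div_norm inner_commute)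
  then have "?\<gamma> t \<bullet> ?\<gamma> t = (cos (norm v * t))\<^sup>2 + (sin (norm v * t))\<^sup>2 * (sgn v \<bullet> sgn v)" for t
    using inner_S2_self[OF assms(1)]
    by (simp add: inner_add_left inner_add_right inner_commute power2_eq_square)
  moreover have "sgn v \<bullet> sgn v = 1 \<or> v = 0"
    by (auto simp: norm_sgn simp flip: norm_eq_1)
  ultimately show "?\<gamma> t \<in> S2" for t
    using assms(1) by (auto simp: S2_def norm_eq_1)
  show "(?\<gamma> has_vector_derivative v) (at 0)"
    by (rule derivative_eq_intros refl | simp add: sgn_div_norm scaleR_scaleR)+ (cases "v = 0"; simp)
qed

lemma derivative_unique_tangent:
  assumes "x \<in> S2" "(F has_derivative L) (at x within S2)" "(F has_derivative L') (at x within S2)"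
    "v \<in> tangent x"
  shows "L v = L' v"
proof -
  obtain \<gamma> where \<gamma>: "\<gamma> (0::real) = x" "\<And>t. \<gamma> t \<in> S2" "(\<gamma> has_vector_derivative v) (at 0)"
    using ex_curve[OF assms(1,4)] by blast
  have "((\<lambda>t. F (\<gamma> t)) has_vector_derivative L v) (at 0)"
    "((\<lambda>t. F (\<gamma> t)) has_vector_derivative L' v) (at 0)"
    by (rule has_vector_derivative_along_curve[OF _ \<gamma>(2,3)]; simp add: \<gamma>(1) assms(2,3))+
  then show ?thesis by (rule vector_derivative_unique_at)
qed

text \<open>Differentiate \<open>F (\<gamma> t) \<bullet> F (\<gamma> t) = 1\<close> along a
  curve.\<close>

lemma derivative_tangent:
  assumes x: "x \<in> S2" and F: "(F has_derivative L) (at x within S2)" "F ` S2 \<subseteq> S2" and v: "v \<in> tangent x"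
  shows "L v \<in> tangent (F x)"
proof -
  obtain \<gamma> where \<gamma>: "\<gamma> (0::real) = x" "\<And>t. \<gamma> t \<in> S2" "(\<gamma> has_vector_derivative v) (at 0)"
    using ex_curve[OF x v] by blast
  have "((\<lambda>t. F (\<gamma> t)) has_vector_derivative L v) (at 0)"
    by (rule has_vector_derivative_along_curve[OF _ \<gamma>(2,3)]) (simp add: \<gamma>(1) F(1))
  then have "((\<lambda>t. F (\<gamma> t) \<bullet> F (\<gamma> t)) has_derivative (\<lambda>t. F x \<bullet> (t *\<^sub>R L v) + (t *\<^sub>R L v) \<bullet> F x)) (at 0)"
    unfolding has_vector_derivative_def using \<gamma>(1) by (auto intro!: derivative_eq_intros)
  note d = this
  have const: "(\<lambda>t. F (\<gamma> t) \<bullet> F (\<gamma> t)) = (\<lambda>t. 1)"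
    using F(2) \<gamma>(2) by (auto intro!: inner_S2_self)
  have "(\<lambda>t. F x \<bullet> (t *\<^sub>R L v) + (t *\<^sub>R L v) \<bullet> F x) = (\<lambda>t. 0)"
    by (rule has_derivative_unique[OF d]) (simp add: const)
  from fun_cong[OF this, of 1] show ?thesis
    by (simp add: tangent_def inner_commute)
qed

text \<open>The choice made inside \<open>tderiv\<close>, before the projection; the two agree on
  tangent vectors.\<close>

definition sderiv :: "(pt \<Rightarrow> pt) \<Rightarrow> pt \<Rightarrow> pt \<Rightarrow> pt" where
  "sderiv f x = (SOME L. (f has_derivative L) (at x within S2))"

lemma sderiv:
  assumes "C1_S2 f" "x \<in> S2"
  shows "(f has_derivative sderiv f x) (at x within S2)"
  using assms unfolding sderiv_def C1_S2_def by (metis someI_ex)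

lemma tderiv_sderiv: "tderiv f x v = sderiv f x (v - (v \<bullet> x) *\<^sub>R x)"
  by (simp add: tderiv_def sderiv_def)

lemma tderiv_tangent: "v \<in> tangent x \<Longrightarrow> tderiv f x v = sderiv f x v"
  by (simp add: tderiv_sderiv tangent_def)

lemma bounded_linear_tderiv:
  assumes "C1_S2 f" "x \<in> S2"
  shows "bounded_linear (tderiv f x)"
  unfolding tderiv_sderiv[abs_def]
  by (rule bounded_linear_compose[OF has_derivative_bounded_linear[OF sderiv[OF assms]]])
     (intro bounded_linear_intros)

text \<open>The circle with diameter \<open>xy\<close> orthogonal to the plane of \<open>x\<close> and \<open>y\<close> lies on the sphere.\<close>
lemma norm_diff_le_on_S2:
  assumes F: "\<And>x. x \<in> S2 \<Longrightarrow> (F has_derivative L x) (at x within S2)"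
    and M: "\<And>x v. x \<in> S2 \<Longrightarrow> v \<in> tangent x \<Longrightarrow> norm (L x v) \<le> M * norm v"
    and xy: "x \<in> S2" "y \<in> S2"
  shows "norm (F x - F y) \<le> 2 * M * norm (x - y)"
proof -
  obtain n where n: "norm n = 1" "n \<bullet> x = 0" "n \<bullet> y = 0"
  proof -
    have "dim {x, y} < DIM(real^3)"
      using dim_le_card'[of "{x, y}"] card_insert_le_m1[of 2 "{y}" x] by simp
    then obtain m where m: "m \<noteq> 0" "\<And>w. w \<in> span {x, y} \<Longrightarrow> orthogonal m w"
      using orthogonal_to_subspace_exists[of "{x, y}"] by auto
    show thesis
      by (rule that[of "sgn m"])
        (use m(1) m(2)[of x] m(2)[of y] in \<open>auto simp: norm_sgn orthogonal_def span_base sgn_div_norm\<close>)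
  qed
  define r where "r = norm (x - y) / 2"
  \<comment> \<open>The circle has centre \<open>m\<close> and orthogonal radii \<open>w\<close> and
    \<open>r n\<close> of equal length. Both are orthogonal to \<open>m\<close> and
    \<open>|m|^2 + r^2 = 1\<close>, so it lies on the sphere.\<close>
  define m where "m = (1/2) *\<^sub>R (x + y)"
  define w where "w = (1/2) *\<^sub>R (x - y)"
  define \<gamma> where "\<gamma> t = m + (cos t *\<^sub>R w + (r * sin t) *\<^sub>R n)" for t
  define \<gamma>' where "\<gamma>' t = (- sin t) *\<^sub>R w + (r * cos t) *\<^sub>R n" for t
  have "x \<bullet> x = 1" "y \<bullet> y = 1" "y \<bullet> x = x \<bullet> y"
    using xy by (auto simp: inner_S2_self inner_commute)
  then have u: "m \<bullet> m = (1 + x \<bullet> y) / 2" "w \<bullet> w = (1 - x \<bullet> y) / 2" "m \<bullet> w = 0" "w \<bullet> m = 0"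
    by (simp_all add: m_def w_def inner_add_left inner_add_right inner_diff_left inner_diff_right
        add_divide_distrib diff_divide_distrib)
  have un: "n \<bullet> n = 1" "m \<bullet> n = 0" "n \<bullet> m = 0" "w \<bullet> n = 0" "n \<bullet> w = 0"
    using n by (auto simp: m_def w_def norm_eq_1 inner_add_left inner_add_right inner_diff_left
        inner_diff_right inner_commute)
  have r: "r\<^sup>2 = (1 - x \<bullet> y) / 2"
    unfolding u(2)[symmetric] by (simp add: r_def w_def power_divide power2_norm_eq_inner)
  have sc: "(cos t)\<^sup>2 * z + (sin t)\<^sup>2 * z = z" for t z :: real
    by (simp add: distrib_right[symmetric])
  have \<gamma>S: "\<gamma> t \<in> S2" for t
  proof -
    have "\<gamma> t \<bullet> \<gamma> t = (1 + x \<bullet> y) / 2 + ((cos t)\<^sup>2 * ((1 - x \<bullet> y) / 2) + (sin t)\<^sup>2 * r\<^sup>2)"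
      by (simp add: \<gamma>_def inner_add_left inner_add_right u un power2_eq_square mult_ac)
    then show ?thesis by (simp add: S2_def norm_eq_1 r sc add_divide_distrib[symmetric])
  qed
  have "\<gamma>' t \<bullet> \<gamma> t = sin t * cos t * (r\<^sup>2 - (1 - x \<bullet> y) / 2)" for t
    by (simp add: \<gamma>_def \<gamma>'_def inner_add_left inner_add_right inner_diff_left inner_diff_right
        u un power2_eq_square mult_ac right_diff_distrib diff_divide_distrib)
  then have tan: "\<gamma>' t \<in> tangent (\<gamma> t)" for t
    by (simp add: tangent_def r)
  have "norm (\<gamma>' t) = r" for t
  proof -
    have "(norm (\<gamma>' t))\<^sup>2 = (cos t)\<^sup>2 * r\<^sup>2 + (sin t)\<^sup>2 * ((1 - x \<bullet> y) / 2)"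
      unfolding power2_norm_eq_inner
      by (simp add: \<gamma>'_def inner_add_left inner_add_right inner_diff_left inner_diff_right u un power2_eq_square mult_ac)
    then have "(norm (\<gamma>' t))\<^sup>2 = r\<^sup>2" by (simp only: r sc)
    then show ?thesis by (simp add: power2_eq_iff_nonneg r_def)
  qed
  then have b: "norm (L (\<gamma> t) (\<gamma>' t)) \<le> M * r" for t
    using M[OF \<gamma>S tan, of t] by simp
  have d\<gamma>: "(\<gamma> has_vector_derivative \<gamma>' t) (at t)" for t
    unfolding \<gamma>_def \<gamma>'_def
    by (auto intro!: derivative_eq_intros simp: algebra_simps)
  have "((\<lambda>t. F (\<gamma> t)) has_derivative (\<lambda>s. s *\<^sub>R L (\<gamma> t) (\<gamma>' t))) (at t within {0..pi})" for t
    by (rule has_derivative_at_withinI)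
      (rule has_vector_derivative_along_curve[unfolded has_vector_derivative_def,
        OF F[OF \<gamma>S] \<gamma>S d\<gamma>[unfolded has_vector_derivative_def]])
  moreover have "onorm (\<lambda>s. s *\<^sub>R L (\<gamma> t) (\<gamma>' t)) \<le> M * r" for t
    by (rule onorm_le) (use mult_left_mono[OF b[of t], of "\<bar>_\<bar>"] in \<open>simp add: mult.commute\<close>)
  ultimately have "norm (F (\<gamma> 0) - F (\<gamma> pi)) \<le> M * r * norm (0 - pi)"
    by (intro differentiable_bound[where S = "{0..pi}"]) auto
  also have "\<gamma> 0 = x"
    by (simp add: \<gamma>_def m_def w_def scaleR_add_right[symmetric] scaleR_2[symmetric])
  also have "\<gamma> pi = y"
    by (simp add: \<gamma>_def m_def w_def scaleR_diff_right[symmetric] scaleR_2[symmetric])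
  \<comment> \<open>The half circle has length \<open>pi * r\<close> with
    \<open>r = norm (x - y) / 2\<close>; replacing pi by 4 gives the factor 2 of the
    statement.\<close>
  also have "M * r * norm (0 - pi) \<le> M * r * 4"
  proof (rule mult_left_mono)
    show "norm (0 - pi) \<le> 4" using pi_less_4 by simp
    show "0 \<le> M * r" using b[of 0] norm_ge_zero order_trans by blast
  qed
  also have "M * r * 4 = 2 * M * norm (x - y)" by (simp add: r_def)
  finally show ?thesis .
qed

text \<open>Continuity of the derivative on a compact set. Apart from Lipschitz bounds, this makes
  the second supremum in \<open>c1dist\<close> a genuine upper bound.\<close>

lemma bdd_above_onorm_tderiv:
  assumes "C1_S2 f"
  shows "\<exists>M. \<forall>x\<in>S2. onorm (tderiv f x) \<le> M"
proof -
  have "continuous_on S2 (\<lambda>x. onorm (tderiv f x))"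
    unfolding continuous_on_iff
  proof (intro ballI allI impI)
    fix x and e :: real assume x: "x \<in> S2" and "0 < e"
    then obtain d where d: "d > 0" "\<And>y. y \<in> S2 \<Longrightarrow> dist y x < d \<Longrightarrow>
        onorm (\<lambda>v. tderiv f y v - tderiv f x v) < e"
      using assms unfolding C1_S2_def by blast
    have "dist (onorm (tderiv f y)) (onorm (tderiv f x)) < e" if y: "y \<in> S2" "dist y x < d" for y
    proof -
      note bl = bounded_linear_tderiv[OF assms x] bounded_linear_tderiv[OF assms y(1)]
      have 1: "onorm (tderiv f y) \<le> onorm (\<lambda>v. tderiv f y v - tderiv f x v) + onorm (tderiv f x)"
        using onorm_triangle[OF bounded_linear_sub[OF bl(2,1)] bl(1)] by simp
      have "onorm (tderiv f x) \<le> onorm (\<lambda>v. tderiv f x v - tderiv f y v) + onorm (tderiv f y)"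
        using onorm_triangle[OF bounded_linear_sub[OF bl] bl(2)] by simp
      also have "onorm (\<lambda>v. tderiv f x v - tderiv f y v) = onorm (\<lambda>v. tderiv f y v - tderiv f x v)"
        using onorm_neg[of "\<lambda>v. tderiv f x v - tderiv f y v"] by simp
      finally show ?thesis using 1 d(2)[OF y] by (simp add: dist_real_def)
    qed
    with d(1) show "\<exists>d>0. \<forall>y\<in>S2. dist y x < d \<longrightarrow> dist (onorm (tderiv f y)) (onorm (tderiv f x)) < e"
      by blast
  qed
  moreover have "compact S2" by (simp add: S2_def)
  ultimately have "bounded ((\<lambda>x. onorm (tderiv f x)) ` S2)"
    by (intro compact_imp_bounded compact_continuous_image)
  then obtain M where "\<forall>x\<in>S2. norm (onorm (tderiv f x)) \<le> M" by (auto simp: bounded_iff)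
  then show ?thesis by (intro exI[of _ M]) (auto simp: abs_le_iff)
qed

lemma C1_S2_lipschitz:
  assumes "C1_S2 f"
  obtains K where "K > 0" "\<And>x y. x \<in> S2 \<Longrightarrow> y \<in> S2 \<Longrightarrow> norm (f x - f y) \<le> K * norm (x - y)"
proof -
  obtain M where M: "\<And>x. x \<in> S2 \<Longrightarrow> onorm (tderiv f x) \<le> M"
    using bdd_above_onorm_tderiv[OF assms] by blast
  show ?thesis
  proof
    show "max 1 (2 * M) > 0" by simp
    fix x y assume xy: "x \<in> S2" "y \<in> S2"
    have "norm (f x - f y) \<le> 2 * M * norm (x - y)"
    proof (rule norm_diff_le_on_S2[OF sderiv[OF assms] _ xy])
      fix x v assume x: "x \<in> S2" and v: "v \<in> tangent x"
      have "norm (sderiv f x v) \<le> onorm (tderiv f x) * norm v"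
        using onorm[OF bounded_linear_tderiv[OF assms x], of v] v by (simp add: tderiv_tangent)
      also have "\<dots> \<le> M * norm v" by (intro mult_right_mono M x) simp
      finally show "norm (sderiv f x v) \<le> M * norm v" .
    qed
    also have "\<dots> \<le> max 1 (2 * M) * norm (x - y)" by (intro mult_right_mono) auto
    finally show "norm (f x - f y) \<le> max 1 (2 * M) * norm (x - y)" .
  qed
qed

lemma c1dist_bounds:
  assumes f: "C1_S2 f" "f ` S2 \<subseteq> S2" and g: "C1_S2 g" "g ` S2 \<subseteq> S2" and x: "x \<in> S2"
  shows "norm (f x - g x) \<le> c1dist f g"
    "onorm (\<lambda>v. tderiv f x v - tderiv g x v) \<le> c1dist f g"
proof -
  have bl: "bounded_linear (\<lambda>v. tderiv f y v - tderiv g y v)" if "y \<in> S2" for y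
    by (intro bounded_linear_sub bounded_linear_tderiv f g that)
  obtain M M' where M: "\<And>x. x \<in> S2 \<Longrightarrow> onorm (tderiv f x) \<le> M" "\<And>x. x \<in> S2 \<Longrightarrow> onorm (tderiv g x) \<le> M'"
    using bdd_above_onorm_tderiv[OF f(1)] bdd_above_onorm_tderiv[OF g(1)] by blast
  have "norm (f y - g y) \<le> 2" if "y \<in> S2" for y
  proof -
    have "f y \<in> S2" "g y \<in> S2" using f(2) g(2) that by auto
    then have "norm (f y) = 1" "norm (g y) = 1" by (auto simp: S2_def)
    then show ?thesis using norm_triangle_ineq4[of "f y" "g y"] by simp
  qed
  then have b1: "bdd_above ((\<lambda>x. norm (f x - g x)) ` S2)" by (intro bdd_aboveI2)
  have "onorm (\<lambda>v. tderiv f y v - tderiv g y v) \<le> M + M'" if y: "y \<in> S2" for y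
  proof -
    note b = bounded_linear_tderiv[OF f(1) y] bounded_linear_tderiv[OF g(1) y]
    have "onorm (\<lambda>v. tderiv f y v + - tderiv g y v) \<le> onorm (tderiv f y) + onorm (\<lambda>v. - tderiv g y v)"
      by (rule onorm_triangle[OF b(1) bounded_linear_minus[OF b(2)]])
    then show ?thesis using M[OF y] by (simp add: onorm_neg)
  qed
  then have b2: "bdd_above ((\<lambda>x. onorm (\<lambda>v. tderiv f x v - tderiv g x v)) ` S2)" by (intro bdd_aboveI2)
  have 1: "norm (f x - g x) \<le> (SUP x\<in>S2. norm (f x - g x))"
    by (rule cSUP_upper[OF x b1])
  have 2: "onorm (\<lambda>v. tderiv f x v - tderiv g x v) \<le> (SUP x\<in>S2. onorm (\<lambda>v. tderiv f x v - tderiv g x v))"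
    by (rule cSUP_upper[OF x b2])
  show "norm (f x - g x) \<le> c1dist f g"
    "onorm (\<lambda>v. tderiv f x v - tderiv g x v) \<le> c1dist f g"
    using 1 2 onorm_pos_le[OF bl[OF x]] norm_ge_zero[of "f x - g x"] unfolding c1dist_def by linarith+
qed

text \<open>Being the identity off the sphere, \<open>g\<close> is a bijection of the whole space,
  and the inverse \<open>inv g\<close> used in words agrees on the sphere with
  \<open>inv_into S2 g\<close>, the map known to be C^1.\<close>

lemma Diff1D:
  assumes "g \<in> Diff1"
  shows "bij_betw g S2 S2" "C1_S2 g" "g ` S2 \<subseteq> S2" "bij g"
    "C1_S2 (inv_into S2 g)" "\<And>x. x \<in> S2 \<Longrightarrow> inv g x = inv_into S2 g x"
    "bij_betw (inv g) S2 S2"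
proof -
  have g: "bij_betw g S2 S2" "C1_S2 g" "C1_S2 (inv_into S2 g)" "\<And>x. x \<notin> S2 \<Longrightarrow> g x = x"
    using assms by (auto simp: Diff1_def)
  then show "bij_betw g S2 S2" "C1_S2 g" "g ` S2 \<subseteq> S2" "C1_S2 (inv_into S2 g)"
    by (auto simp: bij_betw_def)
  have "bij_betw g (- S2) (- S2)"
    using g(4) by (subst bij_betw_cong[where g = id]) auto
  then have "bij_betw g (S2 \<union> - S2) (S2 \<union> - S2)"
    by (intro bij_betw_combine[OF g(1)]) auto
  then show bij: "bij g" by simp
  show inv: "inv g x = inv_into S2 g x" if x: "x \<in> S2" for x
  proof -
    have "g (inv_into S2 g x) = x" using g(1) x by (simp add: bij_betw_inv_into_right)
    then show ?thesis using bij by (metis bij_inv_eq_iff)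
  qed
  show "bij_betw (inv g) S2 S2"
    by (subst bij_betw_cong[OF inv]) (auto intro: bij_betw_inv_into g)
qed

lemma Diff1_lipschitz:
  assumes "g \<in> Diff1"
  obtains K where "K > 0" "\<And>x y. x \<in> S2 \<Longrightarrow> y \<in> S2 \<Longrightarrow> norm (g x - g y) \<le> K * norm (x - y)"
    "\<And>x y. x \<in> S2 \<Longrightarrow> y \<in> S2 \<Longrightarrow> norm (inv g x - inv g y) \<le> K * norm (x - y)"
proof -
  obtain K1 where K1: "K1 > 0" "\<And>x y. x \<in> S2 \<Longrightarrow> y \<in> S2 \<Longrightarrow> norm (g x - g y) \<le> K1 * norm (x - y)"
    by (rule C1_S2_lipschitz[OF Diff1D(2)[OF assms]]) blast
  obtain K2 where K2: "K2 > 0" "\<And>x y. x \<in> S2 \<Longrightarrow> y \<in> S2 \<Longrightarrow>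
      norm (inv_into S2 g x - inv_into S2 g y) \<le> K2 * norm (x - y)"
    by (rule C1_S2_lipschitz[OF Diff1D(5)[OF assms]]) blast
  show thesis
  proof (rule that[of "max K1 K2"])
    show "max K1 K2 > 0" using K1 by simp
    fix x y assume xy: "x \<in> S2" "y \<in> S2"
    have "K1 * norm (x - y) \<le> max K1 K2 * norm (x - y)" "K2 * norm (x - y) \<le> max K1 K2 * norm (x - y)"
      by (intro mult_right_mono; simp)+
    then show "norm (g x - g y) \<le> max K1 K2 * norm (x - y)"
      "norm (inv g x - inv g y) \<le> max K1 K2 * norm (x - y)"
      using K1(2)[OF xy] K2(2)[OF xy] xy by (simp_all only: Diff1D(6)[OF assms])
  qed
qed

lemma Diff1_continuous:
  assumes "g \<in> Diff1"
  shows "continuous_on S2 g" "continuous_on S2 (inv g)"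
proof -
  have *: "continuous_on S2 f" if "K > 0" "\<And>x y. x \<in> S2 \<Longrightarrow> y \<in> S2 \<Longrightarrow> norm (f x - f y) \<le> K * norm (x - y)"
    for f :: "pt \<Rightarrow> pt" and K
    by (rule lipschitz_on_continuous_on[of K]) (use that in \<open>auto intro!: lipschitz_onI simp: dist_norm\<close>)
  show "continuous_on S2 g" by (rule Diff1_lipschitz[OF assms]) (rule *)
  show "continuous_on S2 (inv g)" by (rule Diff1_lipschitz[OF assms]) (rule *)
qed

subsection \<open>The identity component\<close>

text \<open>These sets are stable under pairwise intersection and arbitrary union, so
  \<open>topology\<close> returns the intended open sets and not an unspecified value.\<close>

lemma openin_Diff1_top:
  "openin Diff1_top U \<longleftrightarrow> U \<subseteq> Diff1 \<and> (\<forall>f\<in>U. \<exists>e>0. \<forall>g\<in>Diff1. c1dist f g < e \<longrightarrow> g \<in> U)"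
proof -
  let ?P = "\<lambda>U. U \<subseteq> Diff1 \<and> (\<forall>f\<in>U. \<exists>e>0. \<forall>g\<in>Diff1. c1dist f g < e \<longrightarrow> g \<in> U)"
  have "istopology ?P"
    unfolding istopology_def
  proof (rule conjI; intro allI impI)
    fix S T assume S: "?P S" and T: "?P T"
    show "?P (S \<inter> T)"
    proof (intro conjI ballI)
      show "S \<inter> T \<subseteq> Diff1" using S by blast
      fix f assume f: "f \<in> S \<inter> T"
      obtain e e' where "e > 0" "\<forall>g\<in>Diff1. c1dist f g < e \<longrightarrow> g \<in> S"
        "e' > 0" "\<forall>g\<in>Diff1. c1dist f g < e' \<longrightarrow> g \<in> T"
        using S T f by blast
      then show "\<exists>e>0. \<forall>g\<in>Diff1. c1dist f g < e \<longrightarrow> g \<in> S \<inter> T"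
        by (intro exI[of _ "min e e'"]) auto
    qed
  next
    fix \<K> assume K: "\<forall>K\<in>\<K>. ?P K"
    show "?P (\<Union>\<K>)"
    proof (intro conjI ballI)
      show "\<Union>\<K> \<subseteq> Diff1" using K by blast
      fix f assume "f \<in> \<Union>\<K>"
      then obtain U where U: "U \<in> \<K>" "f \<in> U" by blast
      with K obtain e where "e > 0" "\<forall>g\<in>Diff1. c1dist f g < e \<longrightarrow> g \<in> U" by blast
      with U show "\<exists>e>0. \<forall>g\<in>Diff1. c1dist f g < e \<longrightarrow> g \<in> \<Union>\<K>" by blast
    qed
  qed
  then show ?thesis
    unfolding Diff1_top_def by (simp add: topology_inverse')
qed

lemma topspace_Diff1_top: "topspace Diff1_top = Diff1"
proof
  have "openin Diff1_top Diff1"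
    unfolding openin_Diff1_top using zero_less_one by blast
  then show "Diff1 \<subseteq> topspace Diff1_top" by (rule openin_subset)
  show "topspace Diff1_top \<subseteq> Diff1"
    using openin_topspace[of Diff1_top] unfolding openin_Diff1_top by blast
qed

text \<open>A locally constant property defines a subset of \<open>Diff1\<close> that is both open
  and closed; a connected set through \<open>id\<close> cannot leave it.\<close>

lemma Diff1_0_induct [consumes 1, case_names id near]:
  assumes f: "f \<in> Diff1_0"
    and id: "id \<in> Diff1 \<Longrightarrow> P id"
    and near: "\<And>g. g \<in> Diff1 \<Longrightarrow> \<exists>e>0. \<forall>h\<in>Diff1. c1dist g h < e \<longrightarrow> (P g \<longleftrightarrow> P h)"
  shows "P f"
proof -
  obtain C where C: "connectedin Diff1_top C" "id \<in> C" "f \<in> C"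
    using f unfolding Diff1_0_def connected_component_of_def by auto
  then have sub: "C \<subseteq> Diff1"
    using connectedin_subset_topspace topspace_Diff1_top by blast
  define T where "T = {g \<in> Diff1. P g}"
  have "openin Diff1_top T"
    unfolding openin_Diff1_top T_def using near by blast
  moreover have "openin Diff1_top (Diff1 - T)"
    unfolding openin_Diff1_top T_def using near by blast
  then have "closedin Diff1_top T"
    unfolding closedin_def topspace_Diff1_top by (simp add: T_def)
  ultimately have "C \<subseteq> T \<or> disjnt C T"
    using C(1) connectedin_clopen_cases by blast
  moreover have "id \<in> T" using C(2) sub id by (auto simp: T_def)
  ultimately show ?thesis using C by (auto simp: T_def disjnt_def)
qed

lemma Diff1_0_subset: "Diff1_0 \<subseteq> Diff1"
  unfolding Diff1_0_def topspace_Diff1_top[symmetric] by (rule connected_component_of_subset_topspace)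

lemma c1dist_sderiv:
  assumes "g \<in> Diff1" "h \<in> Diff1" "x \<in> S2" "v \<in> tangent x"
  shows "norm (sderiv g x v - sderiv h x v) \<le> c1dist g h * norm v"
proof -
  note b = bounded_linear_sub[OF bounded_linear_tderiv[OF Diff1D(2)[OF assms(1)] assms(3)]
      bounded_linear_tderiv[OF Diff1D(2)[OF assms(2)] assms(3)]]
  have "norm (sderiv g x v - sderiv h x v) \<le> onorm (\<lambda>v. tderiv g x v - tderiv h x v) * norm v"
    using onorm[OF b, of v] assms(4) by (simp add: tderiv_tangent)
  also have "\<dots> \<le> c1dist g h * norm v"
    by (intro mult_right_mono c1dist_bounds Diff1D assms) simp
  finally show ?thesis .
qed

text \<open>The mean value bound for the difference map \<open>g - h\<close>, whose values need not
  lie on the sphere. It turns C^1 closeness into the closeness of chords that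
  \<open>is_lift_near_identity\<close> requires.\<close>

lemma c1dist_lipschitz:
  assumes gh: "g \<in> Diff1" "h \<in> Diff1" and xy: "x \<in> S2" "y \<in> S2"
  shows "norm ((g x - h x) - (g y - h y)) \<le> 2 * c1dist g h * norm (x - y)"
proof (rule norm_diff_le_on_S2[OF _ _ xy])
  fix x assume x: "x \<in> S2"
  show "((\<lambda>x. g x - h x) has_derivative (\<lambda>v. sderiv g x v - sderiv h x v)) (at x within S2)"
    by (intro has_derivative_diff sderiv Diff1D gh x)
  fix v assume "v \<in> tangent x"
  then show "norm (sderiv g x v - sderiv h x v) \<le> c1dist g h * norm v"
    by (intro c1dist_sderiv gh x)
qed

lemma Diff1_inv_right: "g \<in> Diff1 \<Longrightarrow> g (inv g x) = x"
  using Diff1D(4)[of g] by (simp add: bij_is_surj surj_f_inv_f)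

lemma Diff1_inv_left: "g \<in> Diff1 \<Longrightarrow> inv g (g x) = x"
  using Diff1D(4)[of g] by (simp add: bij_is_inj inv_f_f)

text \<open>Having a lift is locally constant: if \<open>h\<close> is near \<open>g\<close>, then
  \<open>k = h \<circ> inv g\<close> is near the identity, and composing with \<open>k\<close> or
  its inverse carries lifts from \<open>g\<close> to \<open>h\<close> and back.\<close>

lemma Diff1_0_lift:
  assumes "f \<in> Diff1_0"
  shows "\<exists>\<Theta> C. is_lift f \<Theta> C"
  using assms
proof (induction rule: Diff1_0_induct)
  case id
  show ?case using is_lift_id by blast
next
  case (near g)
  obtain K where K: "K > 0" "\<And>x y. x \<in> S2 \<Longrightarrow> y \<in> S2 \<Longrightarrow> norm (inv g x - inv g y) \<le> K * norm (x - y)"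
    by (rule Diff1_lipschitz[OF near]) blast
  \<comment> \<open>On the sphere, \<open>k - id\<close> has Lipschitz constant at most
    \<open>2 * c1dist g h * K\<close>, which must not exceed 1/10.\<close>
  define e where "e = min (1/10) (1 / (20 * K))"
  have "(\<exists>\<Theta> C. is_lift g \<Theta> C) \<longleftrightarrow> (\<exists>\<Theta> C. is_lift h \<Theta> C)" if h: "h \<in> Diff1" and d: "c1dist g h < e" for h
  proof -
    have ig: "inv g x \<in> S2" if "x \<in> S2" for x
      using Diff1D(7)[OF near] that by (auto simp: bij_betw_def)
    define k where "k = h \<circ> inv g"
    have bk: "bij_betw k S2 S2"
      unfolding k_def by (rule bij_betw_trans[OF Diff1D(7)[OF near] Diff1D(1)[OF h]])
    have "\<exists>\<Theta> C. is_lift k \<Theta> C"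
    proof (rule is_lift_near_identity[OF bk])
      fix x assume x: "x \<in> S2"
      have "norm (g (inv g x) - h (inv g x)) \<le> c1dist g h"
        by (intro c1dist_bounds Diff1D near h ig x)
      then show "norm (k x - x) \<le> 1/10"
        using d by (simp add: k_def e_def Diff1_inv_right[OF near] norm_minus_commute)
      fix y assume y: "y \<in> S2"
      have "norm ((k x - k y) - (x - y)) =
          norm ((g (inv g x) - h (inv g x)) - (g (inv g y) - h (inv g y)))"
        unfolding k_def by (subst norm_minus_commute) (simp add: Diff1_inv_right[OF near] algebra_simps)
      also have "\<dots> \<le> 2 * c1dist g h * norm (inv g x - inv g y)"
        by (intro c1dist_lipschitz near h ig x y)
      also have "\<dots> \<le> 2 * (1 / (20 * K)) * (K * norm (x - y))"
        using d K(1) order_trans[OF norm_ge_zero c1dist_bounds(1)[OF Diff1D(2,3)[OF near] Diff1D(2,3)[OF h] x]]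
        by (intro mult_mono K(2) x y) (auto simp: e_def)
      also have "\<dots> = norm (x - y) / 10" using K(1) by simp
      finally show "norm ((k x - k y) - (x - y)) \<le> norm (x - y) / 10" .
    qed
    then obtain \<Theta> C where k: "is_lift k \<Theta> C" by blast
    have 1: "k \<circ> g = h" by (auto simp: k_def Diff1_inv_left[OF near])
    have "bij_betw (g \<circ> inv h) S2 S2"
      by (rule bij_betw_trans[OF Diff1D(7)[OF h] Diff1D(1)[OF near]])
    moreover have "continuous_on S2 (g \<circ> inv h)"
      using Diff1D(7)[OF h] Diff1_continuous(1)[OF near]
      by (intro continuous_on_compose Diff1_continuous(2)[OF h]) (simp add: bij_betw_def)
    moreover have "k ((g \<circ> inv h) x) = x" for x
      by (simp add: k_def Diff1_inv_left[OF near] Diff1_inv_right[OF h])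
    ultimately have k': "is_lift (g \<circ> inv h) (\<lambda>a b c d. - \<Theta> ((g \<circ> inv h) a) ((g \<circ> inv h) b)
        ((g \<circ> inv h) c) ((g \<circ> inv h) d)) C"
      by (rule is_lift_inverse[OF k])
    have 2: "(g \<circ> inv h) \<circ> h = g" by (auto simp: Diff1_inv_left[OF h])
    show ?thesis
      using is_lift_compose[OF k, where h = g] is_lift_compose[OF k', where h = h] unfolding 1 2 by blast
  qed
  moreover have "e > 0" using K(1) by (simp add: e_def)
  ultimately show ?case by blast
qed

text \<open>The chain rule along a curve through \<open>x\<close>, since \<open>sderiv\<close> is
  determined only on tangent vectors.\<close>

lemma sderiv_inverse:
  assumes g: "g \<in> Diff1" and x: "x \<in> S2" and v: "v \<in> tangent x"
  shows "sderiv (inv_into S2 g) (g x) (sderiv g x v) = v"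
proof -
  obtain \<gamma> where \<gamma>: "\<gamma> (0::real) = x" "\<And>t. \<gamma> t \<in> S2" "(\<gamma> has_vector_derivative v) (at 0)"
    using ex_curve[OF x v] by blast
  have gS: "g y \<in> S2" if "y \<in> S2" for y using Diff1D(3)[OF g] that by blast
  have 1: "((\<lambda>t. g (\<gamma> t)) has_vector_derivative sderiv g x v) (at 0)"
    by (rule has_vector_derivative_along_curve[OF _ \<gamma>(2,3)]) (use \<gamma>(1) sderiv[OF Diff1D(2)[OF g] x] in simp)
  have "((\<lambda>t. inv_into S2 g (g (\<gamma> t))) has_vector_derivative
      sderiv (inv_into S2 g) (g x) (sderiv g x v)) (at 0)"
    by (rule has_vector_derivative_along_curve[OF _ gS[OF \<gamma>(2)] 1])
      (use \<gamma>(1) sderiv[OF Diff1D(5)[OF g] gS[OF x]] in simp)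
  moreover have "(\<lambda>t. inv_into S2 g (g (\<gamma> t))) = \<gamma>"
    using Diff1D(1)[OF g] \<gamma>(2) by (auto simp: bij_betw_inv_into_left)
  ultimately show ?thesis
    using \<gamma>(3) by (simp add: vector_derivative_unique_at)
qed

text \<open>Both images are tangent at \<open>g z\<close>, so their cross product is normal to the
  sphere. If the triple product vanished, the images would be linearly dependent, and the derivative
  of the inverse would pull this back to \<open>e1\<close> and \<open>e2\<close>.\<close>

lemma triple_sderiv_nonzero:
  assumes g: "g \<in> Diff1" and z: "z \<in> S2" and e: "e1 \<in> tangent z" "e2 \<in> tangent z" "e1 \<times> e2 \<noteq> 0"
  shows "g z \<bullet> (sderiv g z e1 \<times> sderiv g z e2) \<noteq> 0"
proof
  assume 0: "g z \<bullet> (sderiv g z e1 \<times> sderiv g z e2) = 0"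
  let ?L1 = "sderiv g z e1" and ?L2 = "sderiv g z e2" and ?K = "sderiv (inv_into S2 g) (g z)"
  have gz: "g z \<in> S2" using Diff1D(3)[OF g] z by blast
  have t: "?L1 \<in> tangent (g z)" "?L2 \<in> tangent (g z)"
    by (rule derivative_tangent[OF z sderiv[OF Diff1D(2)[OF g] z] Diff1D(3)[OF g]]; fact)+
  have "g z \<times> (?L1 \<times> ?L2) = 0"
    using t by (simp add: Lagrange tangent_def inner_commute)
  with 0 have "?L1 \<times> ?L2 = 0"
    using norm_and_cross_eq_0[of "g z" "?L1 \<times> ?L2"] gz by (auto simp: S2_def)
  then consider "?L1 = 0" | "?L2 = 0" | c where "?L2 = c *\<^sub>R ?L1"
    unfolding cross_eq_0 collinear_lemma by blast
  then show False
  proof cases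
    have lin: "linear ?K"
      using has_derivative_linear[OF sderiv[OF Diff1D(5)[OF g] gz]] .
    note inv = sderiv_inverse[OF g z e(1)] sderiv_inverse[OF g z e(2)]
    {
      case 1
      then show False using inv(1) linear_0[OF lin] e(3) by (simp add: cross_zero_left)
    next
      case 2
      then show False using inv(2) linear_0[OF lin] e(3) by (simp add: cross_zero_right)
    next
      case (3 c)
      then have "e2 = c *\<^sub>R e1" using inv linear_scale[OF lin] by metis
      then show False using e(3) by (simp add: cross_mult_right cross_refl)
    }
  qed
qed

text \<open>The triple product depends continuously on the map in the C^1 sense and never vanishes
  on \<open>Diff1\<close>, so its sign is locally constant.\<close>

lemma Diff1_0_orientation:
  assumes "f \<in> Diff1_0" and z: "z \<in> S2" and e: "e1 \<in> tangent z" "e2 \<in> tangent z" "z \<bullet> (e1 \<times> e2) > 0"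
  shows "f z \<bullet> (sderiv f z e1 \<times> sderiv f z e2) > 0"
  using assms(1)
proof (induction rule: Diff1_0_induct)
  case id
  have "(id has_derivative (\<lambda>v. v)) (at z within S2)" by (simp add: id_def)
  then have *: "sderiv id z v = v" if "v \<in> tangent z" for v
    by (rule derivative_unique_tangent[OF z sderiv[OF Diff1D(2)[OF id] z] _ that])
  show ?case unfolding *[OF e(1)] *[OF e(2)] using e(3) by simp
next
  case (near g)
  have ne: "e1 \<times> e2 \<noteq> 0" using e(3) by auto
  define \<omega> :: "pt \<times> pt \<times> pt \<Rightarrow> real" where "\<omega> = (\<lambda>(x, u, v). x \<bullet> (u \<times> v))"
  define p where "p g = (g z, sderiv g z e1, sderiv g z e2)" for g
  have nz: "\<omega> (p h) \<noteq> 0" if "h \<in> Diff1" for h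
    using triple_sderiv_nonzero[OF that z e(1,2) ne] by (simp add: p_def \<omega>_def)
  have "continuous_on UNIV \<omega>"
    unfolding \<omega>_def case_prod_beta by (intro continuous_intros continuous_on_cross)
  then obtain d where d: "d > 0" "\<And>q. dist q (p g) < d \<Longrightarrow> dist (\<omega> q) (\<omega> (p g)) < \<bar>\<omega> (p g)\<bar>"
    using nz[OF near] unfolding continuous_on_iff by (metis UNIV_I zero_less_abs_iff)
  \<comment> \<open>One summand for the base point and one for each of the two image vectors in
    \<open>p g\<close>, which move by at most \<open>c1dist g h\<close> times \<open>norm e1\<close>
    and \<open>norm e2\<close>.\<close>
  define c where "c = 1 + norm e1 + norm e2"
  have c: "c > 0" unfolding c_def using norm_ge_zero[of e1] norm_ge_zero[of e2] by linarith
  have "\<omega> (p g) > 0 \<longleftrightarrow> \<omega> (p h) > 0" if h: "h \<in> Diff1" and dist: "c1dist g h < d / c" for h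
  proof -
    have 1: "norm (g z - h z) \<le> c1dist g h"
      by (intro c1dist_bounds Diff1D near h z)
    have "dist (p g) (p h) \<le> norm (g z - h z) + (norm (sderiv g z e1 - sderiv h z e1)
        + norm (sderiv g z e2 - sderiv h z e2))"
      unfolding p_def dist_norm diff_Pair by (intro order_trans[OF norm_Pair_le] add_mono norm_Pair_le order_refl)
    also have "\<dots> \<le> c1dist g h * c"
      using 1 c1dist_sderiv[OF near h z e(1)] c1dist_sderiv[OF near h z e(2)]
      by (simp add: c_def algebra_simps)
    also have "\<dots> < d" using dist c by (simp add: field_simps)
    finally have "dist (\<omega> (p h)) (\<omega> (p g)) < \<bar>\<omega> (p g)\<bar>" by (intro d) (simp add: dist_commute)
    then show ?thesis by (auto simp: dist_real_def)
  qed
  moreover have "d / c > 0" using d c by simp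
  ultimately show ?case unfolding \<omega>_def p_def case_prod_conv by blast
qed

subsection \<open>Words and iterates\<close>

lemma is_lift_mono: "is_lift g \<Theta> C \<Longrightarrow> C \<le> C' \<Longrightarrow> is_lift g \<Theta> C'"
  unfolding is_lift_def by (meson order_trans)

lemma Diff1_0_letters:
  assumes S: "S \<subseteq> Diff1_0" and s: "s \<in> S \<union> inv ` S"
  shows "\<exists>\<Theta> C. is_lift s \<Theta> C"
    and "\<exists>K>0. \<forall>x\<in>S2. \<forall>y\<in>S2. norm (s x - s y) \<le> K * norm (x - y) \<and> norm (x - y) \<le> K * norm (s x - s y)"
proof -
  obtain t where t: "t \<in> Diff1_0" and st: "s = t \<or> s = inv t" using S s by blast
  have D: "t \<in> Diff1" using t Diff1_0_subset by blast
  obtain \<Theta> C where l: "is_lift t \<Theta> C" using Diff1_0_lift[OF t] by blast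
  show "\<exists>\<Theta> C. is_lift s \<Theta> C"
    using st l is_lift_inverse[OF l Diff1D(7)[OF D] Diff1_continuous(2)[OF D] Diff1_inv_right[OF D]] by blast
  obtain K where K: "K > 0" "\<And>x y. x \<in> S2 \<Longrightarrow> y \<in> S2 \<Longrightarrow> norm (t x - t y) \<le> K * norm (x - y)"
    "\<And>x y. x \<in> S2 \<Longrightarrow> y \<in> S2 \<Longrightarrow> norm (inv t x - inv t y) \<le> K * norm (x - y)"
    by (rule Diff1_lipschitz[OF D]) blast
  have tS: "t x \<in> S2" "inv t x \<in> S2" if "x \<in> S2" for x
    using Diff1D(1,7)[OF D] that by (auto simp: bij_betw_def)
  have "norm (x - y) \<le> K * norm (t x - t y)" "norm (x - y) \<le> K * norm (inv t x - inv t y)"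
    if "x \<in> S2" "y \<in> S2" for x y
    using K(3)[OF tS(1)[OF that(1)] tS(1)[OF that(2)]] K(2)[OF tS(2)[OF that(1)] tS(2)[OF that(2)]]
    by (simp_all add: Diff1_inv_left[OF D] Diff1_inv_right[OF D])
  with K st show "\<exists>K>0. \<forall>x\<in>S2. \<forall>y\<in>S2.
      norm (s x - s y) \<le> K * norm (x - y) \<and> norm (x - y) \<le> K * norm (s x - s y)"
    by blast
qed

text \<open>Constants uniform over the finitely many letters: lift bounds add along a word,
  Lipschitz constants multiply.\<close>

lemma word_bounds:
  assumes fin: "finite S" and S: "S \<subseteq> Diff1_0"
  obtains C K :: real where "K \<ge> 1"
    "\<And>xs g. is_word S xs g \<Longrightarrow> \<exists>\<Theta>. is_lift g \<Theta> (C * length xs)"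
    "\<And>xs g x y. is_word S xs g \<Longrightarrow> x \<in> S2 \<Longrightarrow> y \<in> S2 \<Longrightarrow>
       norm (g x - g y) \<le> K ^ length xs * norm (x - y) \<and> norm (x - y) \<le> K ^ length xs * norm (g x - g y)"
proof -
  let ?T = "S \<union> inv ` S"
  have "\<forall>s\<in>?T. \<exists>C. \<exists>\<Theta>. is_lift s \<Theta> C" using Diff1_0_letters(1)[OF S] by blast
  then obtain c where c: "\<And>s. s \<in> ?T \<Longrightarrow> \<exists>\<Theta>. is_lift s \<Theta> (c s)" by metis
  have "\<forall>s\<in>?T. \<exists>K. K > 0 \<and> (\<forall>x\<in>S2. \<forall>y\<in>S2.
      norm (s x - s y) \<le> K * norm (x - y) \<and> norm (x - y) \<le> K * norm (s x - s y))"
    using Diff1_0_letters(2)[OF S] by blast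
  from bchoice[OF this] obtain k where k: "\<And>s x y. s \<in> ?T \<Longrightarrow> x \<in> S2 \<Longrightarrow> y \<in> S2 \<Longrightarrow>
      norm (s x - s y) \<le> k s * norm (x - y) \<and> norm (x - y) \<le> k s * norm (s x - s y)"
    by blast
  \<comment> \<open>The inserted 0 and 1 cover an empty \<open>S\<close>; the 1 also ensures
    \<open>K \<ge> 1\<close>.\<close>
  define C where "C = Max (insert 0 (c ` ?T))"
  define K where "K = Max (insert 1 (k ` ?T))"
  have CK: "c s \<le> C" "k s \<le> K" if "s \<in> ?T" for s
    using that fin unfolding C_def K_def by (intro Max_ge; simp)+
  have K1: "K \<ge> 1" unfolding K_def using fin by (intro Max_ge) auto
  have letter: "\<exists>\<Theta>. is_lift s \<Theta> C" "bij_betw s S2 S2" if "s \<in> ?T" for s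
    using c[OF that] is_lift_mono[OF _ CK(1)[OF that]] by (blast, auto simp: is_lift_def)
  have kK: "norm (s x - s y) \<le> K * norm (x - y)" "norm (x - y) \<le> K * norm (s x - s y)"
    if "s \<in> ?T" "x \<in> S2" "y \<in> S2" for s x y
    using k[OF that] mult_right_mono[OF CK(2)[OF that(1)] norm_ge_zero[of "x - y"]]
      mult_right_mono[OF CK(2)[OF that(1)] norm_ge_zero[of "s x - s y"]] by linarith+
  have lift: "set xs \<subseteq> ?T \<Longrightarrow> \<exists>\<Theta>. is_lift (foldr (\<circ>) xs id) \<Theta> (C * length xs)" for xs
  proof (induction xs)
    case Nil
    show ?case using is_lift_id by (intro exI) (simp add: id_def)
  next
    case (Cons s xs)
    then have "s \<in> ?T" "set xs \<subseteq> ?T" by auto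
    then obtain \<Theta> \<Theta>' where "is_lift s \<Theta> C" "is_lift (foldr (\<circ>) xs id) \<Theta>' (C * length xs)"
      using letter(1)[of s] Cons.IH by blast
    from is_lift_compose[OF this] have "\<exists>\<Theta>. is_lift (s \<circ> foldr (\<circ>) xs id) \<Theta> (C + C * length xs)" by blast
    moreover have "C * real (length (s # xs)) = C + C * length xs" by (simp add: algebra_simps)
    moreover have "foldr (\<circ>) (s # xs) id = s \<circ> foldr (\<circ>) xs id" by simp
    ultimately show ?case by (simp only:)
  qed
  have lip: "set xs \<subseteq> ?T \<Longrightarrow> norm (foldr (\<circ>) xs id x - foldr (\<circ>) xs id y) \<le> K ^ length xs * norm (x - y) \<and>
      norm (x - y) \<le> K ^ length xs * norm (foldr (\<circ>) xs id x - foldr (\<circ>) xs id y)"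
    if xy: "x \<in> S2" "y \<in> S2" for xs x y
  proof (induction xs)
    case Nil
    then show ?case by simp
  next
    case (Cons s xs)
    let ?g = "foldr (\<circ>) xs id"
    have s: "s \<in> ?T" and xs: "set xs \<subseteq> ?T" using Cons.prems by auto
    note IH = Cons.IH[OF xs]
    obtain \<Theta> where "is_lift ?g \<Theta> (C * length xs)" using lift[OF xs] by blast
    then have g: "?g x \<in> S2" "?g y \<in> S2" using xy by (auto simp: is_lift_def bij_betw_def)
    have "norm (s (?g x) - s (?g y)) \<le> K * (K ^ length xs * norm (x - y))"
      using kK(1)[OF s g] mult_left_mono[OF conjunct1[OF IH], of K] K1 by linarith
    moreover have "norm (x - y) \<le> K ^ length xs * (K * norm (s (?g x) - s (?g y)))"
      using conjunct2[OF IH] mult_left_mono[OF kK(2)[OF s g], of "K ^ length xs"] K1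
      by (smt (verit) zero_le_power)
    moreover have "foldr (\<circ>) (s # xs) id w = s (?g w)" for w by simp
    ultimately show ?case by (simp only: length_Cons power_Suc mult_ac)
  qed
  show thesis
  proof (rule that[OF K1])
    fix xs g assume w: "is_word S xs g"
    then have g: "g = foldr (\<circ>) xs id" and xs: "set xs \<subseteq> ?T" by (simp_all only: is_word_def)
    show "\<exists>\<Theta>. is_lift g \<Theta> (C * length xs)" unfolding g by (rule lift[OF xs])
    show "norm (g x - g y) \<le> K ^ length xs * norm (x - y) \<and> norm (x - y) \<le> K ^ length xs * norm (g x - g y)"
      if "x \<in> S2" "y \<in> S2" for x y
      unfolding g by (rule lip[OF that xs])
  qed
qed

text \<open>Some word represents \<open>f ^^ n\<close>, so the \<open>LEAST\<close> in
  \<open>word_length\<close> is attained.\<close>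

lemma is_word_funpow:
  assumes "is_word S xs f"
  shows "is_word S (concat (replicate n xs)) (f ^^ n)"
proof -
  have app: "foldr (\<circ>) (ys @ zs) id = foldr (\<circ>) ys id \<circ> foldr (\<circ>) zs id" for ys zs :: "(pt \<Rightarrow> pt) list"
    by (induction ys) (auto simp: comp_assoc)
  show ?thesis
  proof (induction n)
    case 0
    show ?case by (simp add: is_word_def id_def)
  next
    case (Suc n)
    have "foldr (\<circ>) (xs @ concat (replicate n xs)) id = f ^^ Suc n"
      unfolding app funpow.simps using Suc assms by (simp only: is_word_def)
    then show ?case using Suc assms by (simp add: is_word_def del: foldr_append funpow.simps)
  qed
qed

lemma distortionE:
  assumes "distortion f"
  obtains C K :: real and l :: "nat \<Rightarrow> nat" where "K \<ge> 1" "(\<lambda>n. real (l n) / real n) \<longlonglongrightarrow> 0"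
    "\<And>n. \<exists>\<Theta>. is_lift (f ^^ n) \<Theta> (C * l n)"
    "\<And>n x y. x \<in> S2 \<Longrightarrow> y \<in> S2 \<Longrightarrow> norm ((f ^^ n) x - (f ^^ n) y) \<le> K ^ l n * norm (x - y)"
    "\<And>n x y. x \<in> S2 \<Longrightarrow> y \<in> S2 \<Longrightarrow> norm (x - y) \<le> K ^ l n * norm ((f ^^ n) x - (f ^^ n) y)"
proof -
  obtain S xs where S: "finite S" "S \<subseteq> Diff1_0" "is_word S xs f"
    "(\<lambda>n. real (word_length S (f ^^ n)) / real n) \<longlonglongrightarrow> 0"
    using assms unfolding distortion_def by blast
  show thesis
  proof (rule word_bounds[OF S(1,2)])
    fix C K :: real
    assume CK: "K \<ge> 1"
      "\<And>xs g. is_word S xs g \<Longrightarrow> \<exists>\<Theta>. is_lift g \<Theta> (C * length xs)"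
      "\<And>xs g x y. is_word S xs g \<Longrightarrow> x \<in> S2 \<Longrightarrow> y \<in> S2 \<Longrightarrow>
         norm (g x - g y) \<le> K ^ length xs * norm (x - y) \<and> norm (x - y) \<le> K ^ length xs * norm (g x - g y)"
    show thesis
    proof (rule that[where K = K and l = "\<lambda>n. word_length S (f ^^ n)" and C = C])
      fix n
      have "\<exists>ys. length ys = word_length S (f ^^ n) \<and> is_word S ys (f ^^ n)"
        unfolding word_length_def by (rule LeastI_ex) (use is_word_funpow[OF S(3)] in blast)
      then obtain ys where ys: "length ys = word_length S (f ^^ n)" "is_word S ys (f ^^ n)" by blast
      show "\<exists>\<Theta>. is_lift (f ^^ n) \<Theta> (C * word_length S (f ^^ n))"
        unfolding ys(1)[symmetric] by (rule CK(2)[OF ys(2)])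
      fix x y assume xy: "x \<in> S2" "y \<in> S2"
      show "norm ((f ^^ n) x - (f ^^ n) y) \<le> K ^ word_length S (f ^^ n) * norm (x - y)"
        "norm (x - y) \<le> K ^ word_length S (f ^^ n) * norm ((f ^^ n) x - (f ^^ n) y)"
        using CK(3)[OF ys(2) xy] unfolding ys(1) by blast+
    qed (fact CK S)+
  qed
qed

text \<open>The cocycle summed along orbits. The constant obtained here is linear in
  \<open>n\<close>; uniqueness will replace it by the one of a shortest word.\<close>

lemma is_lift_funpow:
  assumes "is_lift f \<Theta> C"
  shows "is_lift (f ^^ n) (\<lambda>a b c d. \<Sum>i<n. \<Theta> ((f ^^ i) a) ((f ^^ i) b) ((f ^^ i) c) ((f ^^ i) d)) (n * C)"
proof (induction n)
  case 0
  show ?case using is_lift_id by (simp only: funpow.simps of_nat_0 mult_zero_left lessThan_0 sum.empty)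
next
  case (Suc n)
  have "real (Suc n) * C = C + n * C" by (simp add: algebra_simps)
  then show ?case
    using is_lift_compose[OF assms Suc.IH] by (simp only: funpow.simps sum.lessThan_Suc)
qed

text \<open>Divide by \<open>t\<close> and pass to the limit in the difference quotients.\<close>

lemma derivative_bound_curve:
  fixes \<gamma> \<delta> :: "real \<Rightarrow> 'a::real_normed_vector"
  assumes "(\<gamma> has_vector_derivative v) (at 0)" "(\<delta> has_vector_derivative w) (at 0)"
    and le: "\<And>t. norm (\<delta> t - \<delta> 0) \<le> M * norm (\<gamma> t - \<gamma> 0)"
  shows "norm w \<le> M * norm v"
proof (rule tendsto_le[of "at (0::real)"])
  have quot: "((\<lambda>t. (1 / t) *\<^sub>R (\<phi> t - \<phi> 0)) \<longlongrightarrow> u) (at 0)"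
    if "(\<phi> has_vector_derivative u) (at 0)" for \<phi> and u :: 'a
  proof -
    have "((\<lambda>t. norm (\<phi> (0 + t) - \<phi> 0 - t *\<^sub>R u) / norm t) \<longlongrightarrow> 0) (at 0)"
      using that unfolding has_vector_derivative_def has_derivative_at by blast
    then have "((\<lambda>t. norm ((1 / t) *\<^sub>R (\<phi> t - \<phi> 0) - u)) \<longlongrightarrow> 0) (at 0)"
    proof (rule Lim_transform_eventually)
      have "norm (\<phi> (0 + t) - \<phi> 0 - t *\<^sub>R u) / norm t = norm ((1 / t) *\<^sub>R (\<phi> t - \<phi> 0) - u)" if "t \<noteq> 0" for t
      proof -
        have "(1 / t) *\<^sub>R (\<phi> t - \<phi> 0) - u = (1 / t) *\<^sub>R (\<phi> t - \<phi> 0 - t *\<^sub>R u)"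
          using that by (simp add: scaleR_diff_right)
        then show ?thesis by simp
      qed
      then show "\<forall>\<^sub>F t in at 0. norm (\<phi> (0 + t) - \<phi> 0 - t *\<^sub>R u) / norm t =
          norm ((1 / t) *\<^sub>R (\<phi> t - \<phi> 0) - u)"
        by (simp add: eventually_at_filter)
    qed
    then show ?thesis by (simp only: tendsto_norm_zero_iff LIM_zero_iff)
  qed
  show "((\<lambda>t. norm ((1 / t) *\<^sub>R (\<delta> t - \<delta> 0))) \<longlongrightarrow> norm w) (at 0)"
    by (intro tendsto_norm quot assms)
  show "((\<lambda>t. M * norm ((1 / t) *\<^sub>R (\<gamma> t - \<gamma> 0))) \<longlongrightarrow> M * norm v) (at 0)"
    by (intro tendsto_intros quot assms)
  show "\<forall>\<^sub>F t in at 0. norm ((1 / t) *\<^sub>R (\<delta> t - \<delta> 0)) \<le> M * norm ((1 / t) *\<^sub>R (\<gamma> t - \<gamma> 0))"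
  proof (intro always_eventually allI)
    fix t :: real
    show "norm ((1 / t) *\<^sub>R (\<delta> t - \<delta> 0)) \<le> M * norm ((1 / t) *\<^sub>R (\<gamma> t - \<gamma> 0))"
      using mult_left_mono[OF le[of t], of "\<bar>1 / t\<bar>"] by (simp add: mult_ac)
  qed
qed simp

subsection \<open>Infinitesimal behaviour at a fixed point\<close>

lemma ex_tangent_frame:
  assumes "z \<in> S2"
  obtains e1 e2 where "e1 \<in> tangent z" "e2 \<in> tangent z" "norm e1 = 1" "norm e2 = 1" "e1 \<bullet> e2 = 0"
    "z \<bullet> (e1 \<times> e2) = 1" "\<forall>p. p = (p \<bullet> z) *\<^sub>R z + (p \<bullet> e1) *\<^sub>R e1 + (p \<bullet> e2) *\<^sub>R e2"
proof -
  obtain m :: pt where m: "m \<noteq> 0" "orthogonal z m"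
    using orthogonal_to_vector_exists[of z] by auto
  define e1 where "e1 = sgn m"
  define e2 where "e2 = z \<times> e1"
  have zz: "z \<bullet> z = 1" by (rule inner_S2_self[OF assms])
  have "norm e1 = 1" using m by (simp add: e1_def norm_sgn)
  then have e1: "e1 \<bullet> e1 = 1" by (simp add: norm_eq_1)
  have ze1: "z \<bullet> e1 = 0"
    using m by (simp add: e1_def orthogonal_def sgn_div_norm)
  note e1 = e1 ze1
  have e2: "e2 \<bullet> e2 = 1" "z \<bullet> e2 = 0" "e1 \<bullet> e2 = 0"
    using e1 zz by (auto simp: e2_def dot_cross dot_cross_self inner_commute)
  have "e1 \<times> e2 = z"
    using e1 by (simp add: e2_def Lagrange inner_commute)
  then have tr: "z \<bullet> (e1 \<times> e2) = 1" by (simp add: zz)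
  have ex: "p = (p \<bullet> z) *\<^sub>R z + (p \<bullet> e1) *\<^sub>R e1 + (p \<bullet> e2) *\<^sub>R e2" for p
  proof -
    define q where "q = p - ((p \<bullet> z) *\<^sub>R z + (p \<bullet> e1) *\<^sub>R e1 + (p \<bullet> e2) *\<^sub>R e2)"
    have q: "q \<bullet> z = 0" "q \<bullet> e1 = 0" "q \<bullet> e2 = 0"
      using e1 e2 zz by (simp_all add: q_def inner_diff_left inner_add_left inner_diff_right inner_add_right inner_commute)
    have "q \<times> (z \<times> e1) = 0" unfolding Lagrange using q by simp
    then have "q = 0"
      using norm_and_cross_eq_0[of q e2] q e2 by (auto simp: e2_def[symmetric])
    then show ?thesis unfolding q_def by (rule eq_iff_diff_eq_0[THEN iffD2])
  qed
  show thesis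
  proof (rule that)
    show "e1 \<in> tangent z" "e2 \<in> tangent z" "norm e1 = 1" "norm e2 = 1" "e1 \<bullet> e2 = 0"
      using e1 e2 by (simp_all add: tangent_def norm_eq_1 inner_commute)
    show "\<forall>p. p = (p \<bullet> z) *\<^sub>R z + (p \<bullet> e1) *\<^sub>R e1 + (p \<bullet> e2) *\<^sub>R e2"
      by (rule allI) (rule ex)
  qed (fact tr)
qed

text \<open>The image of a punctured disc is connected because the disc is. Squeezing it between two
  round caps makes its exact shape irrelevant.\<close>

lemma punctured_cap:
  assumes z: "z \<in> S2" and r: "r > 0"
  obtains U \<rho> where "connected U" "\<rho> > 0" "U \<noteq> {}" "U \<subseteq> {p \<in> S2. p \<noteq> z \<and> norm (p - z) < r}"
    "{p \<in> S2. p \<noteq> z \<and> norm (p - z) < \<rho>} \<subseteq> U"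
proof -
  obtain e1 e2 where e: "e1 \<in> tangent z" "e2 \<in> tangent z" "norm e1 = 1" "norm e2 = 1" "e1 \<bullet> e2 = 0"
    "z \<bullet> (e1 \<times> e2) = 1" "\<forall>p. p = (p \<bullet> z) *\<^sub>R z + (p \<bullet> e1) *\<^sub>R e1 + (p \<bullet> e2) *\<^sub>R e2"
    by (rule ex_tangent_frame[OF z])
  have i: "z \<bullet> z = 1" "e1 \<bullet> e1 = 1" "e2 \<bullet> e2 = 1" "e1 \<bullet> z = 0" "e2 \<bullet> z = 0" "z \<bullet> e1 = 0" "z \<bullet> e2 = 0"
    "e2 \<bullet> e1 = 0" "e1 \<bullet> e2 = 0"
    using e(1-5) inner_S2_self[OF z] by (auto simp: norm_eq_1 tangent_def inner_commute)
  \<comment> \<open>The hemisphere around \<open>z\<close> as a graph over the unit disc in the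
    tangent plane.\<close>
  define \<phi> where "\<phi> w = sqrt (1 - (cmod w)\<^sup>2) *\<^sub>R z + Re w *\<^sub>R e1 + Im w *\<^sub>R e2" for w
  have cont: "continuous_on UNIV \<phi>"
    unfolding \<phi>_def by (intro continuous_intros)
  have \<phi>0: "\<phi> 0 = z" by (simp add: \<phi>_def)
  obtain \<rho>0 where \<rho>0: "\<rho>0 > 0" "\<And>w. cmod w < \<rho>0 \<Longrightarrow> norm (\<phi> w - z) < r"
  proof -
    have "\<exists>e>0. \<forall>w\<in>UNIV. dist w 0 < e \<longrightarrow> dist (\<phi> w) (\<phi> 0) < r"
      using cont r unfolding continuous_on_iff by blast
    then show thesis using that by (auto simp: \<phi>0 dist_norm)
  qed
  define \<rho> where "\<rho> = min \<rho>0 1"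
  have \<rho>: "\<rho> > 0" "\<rho> \<le> \<rho>0" "\<rho> \<le> 1" using \<rho>0 by (auto simp: \<rho>_def)
  define U where "U = \<phi> ` (ball 0 \<rho> - {0})"
  show thesis
  proof (rule that[of U \<rho>])
    show "connected U"
      unfolding U_def
      by (intro connected_continuous_image continuous_on_subset[OF cont]
          path_connected_imp_connected path_connected_punctured_ball) auto
    show "\<rho> > 0" by fact
    have "complex_of_real (\<rho> / 2) \<in> ball 0 \<rho> - {0}" using \<rho> by auto
    then show "U \<noteq> {}" unfolding U_def by blast
    show "U \<subseteq> {p \<in> S2. p \<noteq> z \<and> norm (p - z) < r}"
    proof
      fix p assume "p \<in> U"
      then obtain w where w: "p = \<phi> w" "cmod w < \<rho>" "w \<noteq> 0"
        unfolding U_def mem_ball_0[symmetric] by blast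
      have "(cmod w)\<^sup>2 \<le> 1" using w(2) \<rho>(3) by (simp add: power_le_one)
      then have "p \<bullet> p = 1"
        unfolding w(1) \<phi>_def
        by (simp add: inner_add_left inner_add_right i cmod_power2 power2_eq_square[symmetric])
      then have "p \<in> S2" by (simp add: S2_def norm_eq_1)
      moreover have "p \<noteq> z"
      proof
        assume "p = z"
        then have "\<phi> w \<bullet> e1 = 0" "\<phi> w \<bullet> e2 = 0" using w(1) i by auto
        then have "Re w = 0" "Im w = 0" by (simp_all add: \<phi>_def inner_add_left i)
        then show False using w(3) by (simp add: complex_eq_iff)
      qed
      ultimately show "p \<in> {p \<in> S2. p \<noteq> z \<and> norm (p - z) < r}"
        using \<rho>0(2)[of w] w \<rho> by auto
    qed
    show "{p \<in> S2. p \<noteq> z \<and> norm (p - z) < \<rho>} \<subseteq> U"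
    proof
      fix p assume "p \<in> {p \<in> S2. p \<noteq> z \<and> norm (p - z) < \<rho>}"
      then have p: "p \<in> S2" "p \<noteq> z" "norm (p - z) < \<rho>" by auto
      define w where "w = Complex (p \<bullet> e1) (p \<bullet> e2)"
      have "p \<bullet> p = (p \<bullet> z) * (p \<bullet> z) + (p \<bullet> e1) * (p \<bullet> e1) + (p \<bullet> e2) * (p \<bullet> e2)"
        using arg_cong[OF e(7)[rule_format, of p], of "\<lambda>q. p \<bullet> q"] by (simp add: inner_add_right)
      then have cw: "(cmod w)\<^sup>2 = 1 - (p \<bullet> z)\<^sup>2"
        using inner_S2_self[OF p(1)] unfolding w_def cmod_power2 by (simp add: power2_eq_square)
      have pz: "1 - p \<bullet> z = (norm (p - z))\<^sup>2 / 2" by (rule inner_S2[OF p(1) z])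
      have n1: "(norm (p - z))\<^sup>2 \<le> 1" using p(3) \<rho>(3) by (simp add: power_le_one)
      have pos: "p \<bullet> z > 0" using pz n1 by linarith
      \<comment> \<open>Projecting to the tangent plane does not increase the distance to
        \<open>z\<close>, so the radius of the disc also serves for the inner cap;
        \<open>p \<bullet> z > 0\<close> selects the right sheet of the graph.\<close>
      have "(cmod w)\<^sup>2 \<le> (norm (p - z))\<^sup>2"
      proof -
        have "(norm (p - z))\<^sup>2 = 2 * (1 - p \<bullet> z)" using pz by simp
        moreover have "2 * (1 - p \<bullet> z) - (1 - (p \<bullet> z)\<^sup>2) = (1 - p \<bullet> z)\<^sup>2"
          by (simp add: power2_eq_square algebra_simps)
        ultimately show ?thesis using cw zero_le_power2[of "1 - p \<bullet> z"] by linarith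
      qed
      then have "cmod w \<le> norm (p - z)" by (rule power2_le_imp_le) simp
      then have "cmod w < \<rho>" using p(3) by linarith
      moreover have ph: "\<phi> w = p"
        unfolding \<phi>_def cw using e(7)[rule_format, of p, symmetric] pos by (simp add: w_def)
      moreover have "w \<noteq> 0" using ph \<phi>0 p(2) by auto
      ultimately show "p \<in> U" unfolding U_def by (auto intro!: image_eqI[of _ _ w])
    qed
  qed
qed

text \<open>The linear part of the amplitude in its second point. As \<open>bargmann\<close> is
  affine in each argument and the amplitude vanishes at \<open>p = z\<close>, it is exactly this
  linear function of \<open>p - z\<close>, with no remainder.\<close>

definition cross_lin :: "pt \<Rightarrow> pt \<Rightarrow> pt \<Rightarrow> pt \<Rightarrow> complex" where
  "cross_lin z c d v = Complex (- ((z \<bullet> v) * (1 - c \<bullet> d)) - v \<bullet> (c - d) - (z \<times> v) \<bullet> (c \<times> d))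
     (v \<bullet> (c \<times> d) - (z \<times> v) \<bullet> (c - d))"

lemma linear_cross_lin: "linear (cross_lin z c d)"
  by (rule linearI) (simp_all add: cross_lin_def complex_eq_iff inner_add_left inner_add_right
      cross_add_right cross_mult_right algebra_simps)

lemma cross_amp_eq_cross_lin:
  assumes "z \<in> S2"
  shows "cross_amp z p c d = cross_lin z c d (p - z)"
  using inner_S2_self[OF assms]
  by (simp add: cross_amp_def bargmann_def cross_lin_def cross_minus_right cross_minus_left Cross3.right_diff_distrib
      cross_refl inner_diff_left inner_diff_right algebra_simps)

text \<open>If a unit tangent vector \<open>u\<close> lay in the kernel, the chords from
  \<open>z\<close> to \<open>u\<close>, \<open>- u\<close> and \<open>- z\<close> would be mapped to
  multiples of the value at \<open>z\<close>. The norm formula at the three points then forces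
  \<open>z \<bullet> c = 1\<close>, so \<open>c = z\<close>.\<close>

lemma cross_lin_nonzero:
  assumes S: "z \<in> S2" "c \<in> S2" "d \<in> S2" and ne: "z \<noteq> c" "c \<noteq> d" "d \<noteq> z"
    and v: "v \<in> tangent z" "v \<noteq> 0"
  shows "cross_lin z c d v \<noteq> 0"
proof
  assume 0: "cross_lin z c d v = 0"
  let ?l = "cross_lin z c d"
  define u where "u = sgn v"
  have u: "u \<in> S2" "u \<bullet> z = 0" "z \<bullet> u = 0"
    using v by (auto simp: u_def S2_def norm_sgn sgn_div_norm tangent_def inner_commute)
  have lu: "?l u = 0"
    using 0 linear_scale[OF linear_cross_lin] by (simp add: u_def sgn_div_norm)
  have l1: "?l (u - z) = - ?l z" "?l (- u - z) = - ?l z"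
    using lu linear_diff[OF linear_cross_lin, of z c d] linear_neg[OF linear_cross_lin, of z c d] by simp_all
  have l2: "?l (- z - z) = - (2 * ?l z)"
    using linear_diff[OF linear_cross_lin, of z c d "- z" z] linear_neg[OF linear_cross_lin, of z c d z] by simp
  define K where "K = 4 * (1 - c \<bullet> d) * (1 - d \<bullet> z)"
  have K: "K > 0"
    using ne by (simp add: K_def inner_S2 S)
  have n: "(cmod (?l (p - z)))\<^sup>2 = K * ((1 - z \<bullet> p) * (1 - p \<bullet> c))" if "p \<in> S2" for p
    using cross_amp_norm[OF S(1) that S(2,3)] cross_amp_eq_cross_lin[OF S(1)] unfolding K_def by (simp only: mult_ac)
  have "(cmod (?l z))\<^sup>2 = K * (1 - u \<bullet> c)" "(cmod (?l z))\<^sup>2 = K * (1 + u \<bullet> c)"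
    using n[of u] n[of "- u"] u l1 by simp_all
  then have "K * (u \<bullet> c) = 0" by (simp add: algebra_simps)
  then have "(cmod (?l z))\<^sup>2 = K"
    using \<open>(cmod (?l z))\<^sup>2 = K * (1 - u \<bullet> c)\<close> K by simp
  moreover have "4 * (cmod (?l z))\<^sup>2 = K * (2 * (1 + z \<bullet> c))"
    using n[of "- z"] S l2 by (simp add: inner_S2_self norm_mult power_mult_distrib)
  ultimately have "z \<bullet> c = 1" using K by simp
  then show False using inner_S2[OF S(1,2)] ne(1) by simp
qed

text \<open>Blow-up at \<open>z\<close>: if \<open>\<Theta>\<close> tends to 0 along points
  approaching \<open>z\<close> in a limit direction \<open>v\<close>, then \<open>cross_lin\<close>
  has the same phase at \<open>v\<close> and \<open>L v\<close>. Being injective on the tangent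
  plane, it makes \<open>L v\<close> a nonnegative multiple of \<open>v\<close>.\<close>

lemma lift_bounded_away:
  assumes f: "is_lift f \<Theta> C" and D: "(f has_derivative L) (at z within S2)" "f ` S2 \<subseteq> S2"
    and S: "z \<in> S2" "c \<in> S2" "d \<in> S2" and ne: "z \<noteq> c" "c \<noteq> d" "d \<noteq> z"
    and fx: "f z = z" "f c = c" "f d = d"
    and noev: "\<And>v s. v \<in> tangent z \<Longrightarrow> v \<noteq> 0 \<Longrightarrow> s \<ge> 0 \<Longrightarrow> L v \<noteq> s *\<^sub>R v"
  shows "\<exists>r>0. \<exists>\<delta>>0. \<forall>p\<in>S2. p \<noteq> z \<and> norm (p - z) < r \<longrightarrow> \<delta> \<le> \<bar>\<Theta> z p c d\<bar>"
proof (rule ccontr)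
  assume neg: "\<not> ?thesis"
  let ?l = "cross_lin z c d"
  \<comment> \<open>The term \<open>norm (z - c)\<close> keeps the points different from
    \<open>c\<close>, as \<open>quad\<close> demands.\<close>
  define \<epsilon> where "\<epsilon> n = min (norm (z - c)) (1 / real (Suc n))" for n
  have \<epsilon>: "\<epsilon> n > 0" "\<epsilon> n \<le> 1 / real (Suc n)" "\<epsilon> n \<le> norm (z - c)" for n
    using ne by (auto simp: \<epsilon>_def)
  have "\<exists>p. p \<in> S2 \<and> p \<noteq> z \<and> norm (p - z) < \<epsilon> n \<and> \<bar>\<Theta> z p c d\<bar> < \<epsilon> n" for n
    using neg \<epsilon>(1)[of n] by (metis not_le)
  then obtain p where p: "\<And>n. p n \<in> S2" "\<And>n. p n \<noteq> z" "\<And>n. norm (p n - z) < \<epsilon> n"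
      "\<And>n. \<bar>\<Theta> z (p n) c d\<bar> < \<epsilon> n"
    by metis
  have pc: "p n \<noteq> c" for n using p(3)[of n] \<epsilon>(3)[of n] by (auto simp: norm_minus_commute)
  have \<epsilon>0: "\<epsilon> \<longlonglongrightarrow> 0"
    by (rule tendsto_sandwich[OF _ _ tendsto_const LIMSEQ_inverse_real_of_nat])
      (use \<epsilon> in \<open>auto simp: inverse_eq_divide less_imp_le\<close>)
  have pz0: "(\<lambda>n. norm (p n - z)) \<longlonglongrightarrow> 0"
    by (rule tendsto_sandwich[OF _ _ tendsto_const \<epsilon>0]) (use p(3) in \<open>auto intro!: always_eventually less_imp_le\<close>)
  then have "p \<longlonglongrightarrow> z" by (simp add: tendsto_norm_zero_iff LIM_zero_iff)
  then have plim: "filterlim p (at z within S2) sequentially"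
    using p by (auto simp: filterlim_at)
  have "(\<lambda>n. \<bar>\<Theta> z (p n) c d\<bar>) \<longlonglongrightarrow> 0"
    by (rule tendsto_sandwich[OF _ _ tendsto_const \<epsilon>0]) (use p(4) in \<open>auto intro!: always_eventually less_imp_le\<close>)
  then have \<Theta>0: "(\<lambda>n. \<Theta> z (p n) c d) \<longlonglongrightarrow> 0" by (simp add: tendsto_rabs_zero_iff)
  define u where "u n = (1 / norm (p n - z)) *\<^sub>R (p n - z)" for n
  have "u n \<in> sphere 0 1" for n using p(2) by (simp add: u_def)
  then obtain v k where k: "strict_mono k" "(u \<circ> k) \<longlonglongrightarrow> v" and v1: "v \<in> sphere 0 1"
    using compact_sphere[of "0::pt" 1] unfolding compact_def by metis
  have v0: "v \<noteq> 0" using v1 by auto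
  have sub: "(\<lambda>n. X (k n)) \<longlonglongrightarrow> x" if "X \<longlonglongrightarrow> x" for X :: "nat \<Rightarrow> 'b::topological_space" and x
    using LIMSEQ_subseq_LIMSEQ[OF that k(1)] by (simp add: o_def)
  have uk: "(\<lambda>n. u (k n)) \<longlonglongrightarrow> v" using k(2) by (simp add: o_def)
  \<comment> \<open>The normal part of a unit chord is half the length of the chord, so limit
    directions are tangent.\<close>
  have "u n \<bullet> z = - norm (p n - z) / 2" for n
  proof -
    have "(p n - z) \<bullet> z = - ((norm (p n - z))\<^sup>2 / 2)"
      using inner_S2[OF p(1) S(1), of n] inner_S2_self[OF S(1)] by (simp add: inner_diff_left)
    then show ?thesis using p(2)[of n] by (simp add: u_def power2_eq_square)
  qed
  moreover have "(\<lambda>n. - norm (p (k n) - z) / 2) \<longlonglongrightarrow> - 0 / 2"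
    by (intro tendsto_intros sub[OF pz0]) simp
  ultimately have "(\<lambda>n. u (k n) \<bullet> z) \<longlonglongrightarrow> 0" by simp
  moreover have "(\<lambda>n. u (k n) \<bullet> z) \<longlonglongrightarrow> v \<bullet> z" by (intro tendsto_intros uk)
  ultimately have vt: "v \<in> tangent z"
    using LIMSEQ_unique by (auto simp: tangent_def)
  have bl: "bounded_linear L" using D(1) by (rule has_derivative_bounded_linear)
  define w where "w n = (1 / norm (p n - z)) *\<^sub>R (f (p n) - z)" for n
  have "(\<lambda>n. norm (f (p n) - f z - L (p n - z)) / norm (p n - z)) \<longlonglongrightarrow> 0"
    using filterlim_compose[OF _ plim] D(1) unfolding has_derivative_iff_norm by blast
  moreover have "norm (f (p n) - f z - L (p n - z)) / norm (p n - z) = norm (w n - L (u n))" for n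
  proof -
    have "w n - L (u n) = (1 / norm (p n - z)) *\<^sub>R (f (p n) - f z - L (p n - z))"
      unfolding w_def u_def linear_scale[OF bounded_linear.linear[OF bl]] fx(1)
      by (simp only: scaleR_diff_right)
    then show ?thesis by simp
  qed
  ultimately have "(\<lambda>n. norm (w n - L (u n))) \<longlonglongrightarrow> 0" by simp
  then have "(\<lambda>n. w n - L (u n)) \<longlonglongrightarrow> 0" by (simp only: tendsto_norm_zero_iff)
  from tendsto_add[OF sub[OF this] bounded_linear.tendsto[OF bl uk]]
  have wk: "(\<lambda>n. w (k n)) \<longlonglongrightarrow> L v" by simp
  have blc: "bounded_linear ?l"
    using linear_cross_lin linear_conv_bounded_linear by blast
  have Lt: "L v \<in> tangent z"
    using derivative_tangent[OF S(1) D vt] fx(1) by simp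
  \<comment> \<open>The case \<open>s = 0\<close> of the hypothesis; it makes the phase at
    \<open>L v\<close> meaningful.\<close>
  have Lv0: "L v \<noteq> 0" using noev[OF vt v0, of 0] by simp
  have nz: "?l v \<noteq> 0" "?l (L v) \<noteq> 0"
    using cross_lin_nonzero[OF S ne vt v0] cross_lin_nonzero[OF S ne Lt Lv0] by auto
  have eq: "sgn (?l (w n)) = cis (\<Theta> z (p n) c d) * sgn (?l (u n))" for n
  proof -
    have "quad z (p n) c d" using S ne p(1,2)[of n] pc[of n] by (auto simp: quad_def)
    then have "sgn (cross_amp (f z) (f (p n)) (f c) (f d)) = cis (\<Theta> z (p n) c d) * sgn (cross_amp z (p n) c d)"
      using f unfolding is_lift_def by blast
    then have "sgn (?l (f (p n) - z)) = cis (\<Theta> z (p n) c d) * sgn (?l (p n - z))"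
      by (simp only: fx cross_amp_eq_cross_lin[OF S(1)])
    moreover have "?l (w n) = (1 / norm (p n - z)) *\<^sub>R ?l (f (p n) - z)"
        "?l (u n) = (1 / norm (p n - z)) *\<^sub>R ?l (p n - z)"
      unfolding w_def u_def by (rule linear_scale[OF linear_cross_lin])+
    moreover have "sgn (1 / norm (p n - z)) = 1" using p(2)[of n] by simp
    ultimately show ?thesis by (simp add: sgn_scaleR)
  qed
  have l1: "(\<lambda>n. sgn (?l (w (k n)))) \<longlonglongrightarrow> sgn (?l (L v))"
    by (intro tendsto_sgn bounded_linear.tendsto[OF blc] wk nz)
  have "(\<lambda>n. cis (\<Theta> z (p (k n)) c d)) \<longlonglongrightarrow> cis 0"
    unfolding cis_conv_exp by (intro tendsto_intros sub[OF \<Theta>0])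
  then have l2: "(\<lambda>n. cis (\<Theta> z (p (k n)) c d) * sgn (?l (u (k n)))) \<longlonglongrightarrow> cis 0 * sgn (?l v)"
    by (intro tendsto_mult tendsto_sgn bounded_linear.tendsto[OF blc] uk nz)
  have sg: "sgn (?l (L v)) = sgn (?l v)"
    using LIMSEQ_unique[OF l1 l2[folded eq]] by simp
  define s where "s = norm (?l (L v)) / norm (?l v)"
  have "?l (L v) = norm (?l (L v)) *\<^sub>R sgn (?l (L v))" by (simp add: sgn_div_norm nz)
  also have "\<dots> = s *\<^sub>R ?l v" unfolding sg by (simp add: s_def sgn_div_norm divide_inverse)
  finally have "?l (L v - s *\<^sub>R v) = 0"
    by (simp add: linear_diff[OF linear_cross_lin] linear_scale[OF linear_cross_lin])
  moreover have "L v - s *\<^sub>R v \<in> tangent z"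
    using Lt vt by (simp add: tangent_def inner_diff_left)
  ultimately have "L v - s *\<^sub>R v = 0"
    using cross_lin_nonzero[OF S ne] by blast
  then show False using noev[OF vt v0, of s] by (simp add: s_def)
qed

section \<open>Growth of the argument along an orbit near the fixed point\<close>

text \<open>As \<open>z\<close>, \<open>c\<close> and \<open>d\<close> are fixed, only the second
  point moves. The bound \<open>C * l n\<close> does not depend on it, so the starting point may be
  chosen after \<open>n\<close>.\<close>

lemma distortion_nonneg_eigenvector:
  assumes dist: "distortion f"
    and S: "z \<in> S2" "c \<in> S2" "d \<in> S2" and ne: "z \<noteq> c" "c \<noteq> d" "d \<noteq> z"
    and fx: "f z = z" "f c = c" "f d = d"
  shows "\<exists>v s. v \<in> tangent z \<and> v \<noteq> 0 \<and> s \<ge> 0 \<and> sderiv f z v = s *\<^sub>R v"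
proof (rule ccontr)
  assume neg: "\<not> ?thesis"
  have f0: "f \<in> Diff1_0" using dist by (simp add: distortion_def)
  then have fD: "f \<in> Diff1" using Diff1_0_subset by blast
  obtain \<Theta> C0 where lift: "is_lift f \<Theta> C0" using Diff1_0_lift[OF f0] by blast
  obtain C K :: real and l :: "nat \<Rightarrow> nat" where l: "(\<lambda>n. real (l n) / real n) \<longlonglongrightarrow> 0"
    "\<And>n. \<exists>\<Theta>. is_lift (f ^^ n) \<Theta> (C * l n)"
    by (rule distortionE[OF dist]) blast
  have fixn: "(f ^^ n) z = z" "(f ^^ n) c = c" "(f ^^ n) d = d" for n
    using fx by (induction n) auto
  have sumb: "\<bar>\<Sum>i<n. \<Theta> z ((f ^^ i) p) c d\<bar> \<le> C * l n" if "quad z p c d" for n p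
  proof -
    obtain \<Theta>' where \<Theta>': "is_lift (f ^^ n) \<Theta>' (C * l n)" using l(2) by blast
    have "(\<Sum>i<n. \<Theta> ((f ^^ i) z) ((f ^^ i) p) ((f ^^ i) c) ((f ^^ i) d)) = \<Theta>' z p c d"
      by (rule is_lift_unique[OF is_lift_funpow[OF lift] \<Theta>' refl that])
    then show ?thesis
      using \<Theta>' that unfolding fixn is_lift_def by simp
  qed
  have "\<exists>r>0. \<exists>\<delta>>0. \<forall>p\<in>S2. p \<noteq> z \<and> norm (p - z) < r \<longrightarrow> \<delta> \<le> \<bar>\<Theta> z p c d\<bar>"
    by (rule lift_bounded_away[OF lift sderiv[OF Diff1D(2)[OF fD] S(1)] Diff1D(3)[OF fD] S ne fx])
      (use neg in blast)
  then obtain r0 \<delta> where r0: "r0 > 0" "\<delta> > 0"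
    "\<And>p. p \<in> S2 \<Longrightarrow> p \<noteq> z \<Longrightarrow> norm (p - z) < r0 \<Longrightarrow> \<delta> \<le> \<bar>\<Theta> z p c d\<bar>"
    by blast
  \<comment> \<open>Keeps \<open>c\<close> outside \<open>U\<close>, so that \<open>\<Theta>\<close>
    is continuous in its second point on \<open>U\<close>.\<close>
  define r where "r = min r0 (norm (z - c))"
  have "r > 0" using r0 ne by (simp add: r_def)
  then obtain U \<rho> where U: "connected U" "\<rho> > 0" "U \<subseteq> {p \<in> S2. p \<noteq> z \<and> norm (p - z) < r}"
    "{p \<in> S2. p \<noteq> z \<and> norm (p - z) < \<rho>} \<subseteq> U"
    by (rule punctured_cap[OF S(1)]) blast
  have Uc: "U \<subseteq> S2 - {z, c}" using U(3) by (auto simp: r_def norm_minus_commute)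
  have "quad z d c d" using S ne by (auto simp: quad_def)
  then have "continuous_on (S2 - {z, c}) (\<lambda>p. \<Theta> z p c d)"
    using lift unfolding is_lift_def by blast
  then have conn: "connected ((\<lambda>p. \<Theta> z p c d) ` U)"
    by (intro connected_continuous_image U continuous_on_subset[OF _ Uc])
  have away: "\<delta> \<le> \<bar>\<Theta> z p c d\<bar>" if "p \<in> U" for p
    using r0(3)[of p] U(3) that by (auto simp: r_def)
  \<comment> \<open>A continuous function on a connected set that avoids a neighbourhood of 0 has
    constant sign, so nothing cancels along an orbit in \<open>U\<close>.\<close>
  have "(\<forall>p\<in>U. \<delta> \<le> \<Theta> z p c d) \<or> (\<forall>p\<in>U. \<Theta> z p c d \<le> - \<delta>)"
  proof (rule ccontr)
    assume "\<not> ?thesis"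
    then obtain p q where pq: "p \<in> U" "q \<in> U" "\<Theta> z p c d < \<delta>" "- \<delta> < \<Theta> z q c d" by (auto simp: not_le)
    then have "\<Theta> z p c d \<le> 0" "0 \<le> \<Theta> z q c d"
      using away[of p] away[of q] by linarith+
    then have "0 \<in> (\<lambda>p. \<Theta> z p c d) ` U"
      using conn pq by (meson connectedD_interval imageI)
    then show False using away r0(2) by force
  qed
  then have sign: "n * \<delta> \<le> \<bar>\<Sum>i<n. \<Theta> z (q i) c d\<bar>" if "\<And>i. i < n \<Longrightarrow> q i \<in> U" for n and q :: "nat \<Rightarrow> pt"
  proof
    assume "\<forall>p\<in>U. \<delta> \<le> \<Theta> z p c d"
    then have "(\<Sum>i<n. \<delta>) \<le> (\<Sum>i<n. \<Theta> z (q i) c d)" using that by (intro sum_mono) auto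
    then show ?thesis by simp
  next
    assume "\<forall>p\<in>U. \<Theta> z p c d \<le> - \<delta>"
    then have "(\<Sum>i<n. \<Theta> z (q i) c d) \<le> (\<Sum>i<n. - \<delta>)" using that by (intro sum_mono) auto
    then show ?thesis by simp
  qed
  obtain M0 where M0: "\<And>x y. x \<in> S2 \<Longrightarrow> y \<in> S2 \<Longrightarrow> norm (f x - f y) \<le> M0 * norm (x - y)"
    by (rule Diff1_lipschitz[OF fD]) blast
  define M where "M = max 1 M0"
  have M: "norm (f x - f y) \<le> M * norm (x - y)" if "x \<in> S2" "y \<in> S2" for x y
    using M0[OF that] mult_right_mono[of M0 M "norm (x - y)"] by (simp add: M_def)
  have fS: "(f ^^ i) x \<in> S2" if "x \<in> S2" for i x
    using that Diff1D(3)[OF fD] by (induction i) auto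
  have iter: "norm ((f ^^ i) x - z) \<le> M ^ i * norm (x - z)" if "x \<in> S2" for i x
  proof (induction i)
    case 0
    then show ?case by simp
  next
    case (Suc i)
    have "norm (f ((f ^^ i) x) - f z) \<le> M * norm ((f ^^ i) x - z)" by (rule M[OF fS[OF that] S(1)])
    also have "\<dots> \<le> M * (M ^ i * norm (x - z))" by (intro mult_left_mono Suc) (simp add: M_def)
    finally show ?case by (simp add: fx mult_ac)
  qed
  have main: "n * \<delta> \<le> C * l n" for n
  proof -
    have Mn: "M ^ n > 0" by (simp add: M_def)
    have "\<rho> / M ^ n > 0" using U(2) Mn by simp
    then have pos: "min (\<rho> / M ^ n) r > 0" using \<open>r > 0\<close> by simp
    \<comment> \<open>Supplies a point so close to \<open>z\<close> that its iterates of index below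
      \<open>n\<close> all stay within \<open>\<rho>\<close>, hence in \<open>U\<close>.\<close>
    obtain V where V: "V \<noteq> {}" "V \<subseteq> {p \<in> S2. p \<noteq> z \<and> norm (p - z) < min (\<rho> / M ^ n) r}"
      by (rule punctured_cap[OF S(1) pos]) blast
    then obtain p where p: "p \<in> S2" "p \<noteq> z" "norm (p - z) < \<rho> / M ^ n" "norm (p - z) < r" by auto
    have "(f ^^ i) p \<in> U" if "i < n" for i
    proof -
      have "M ^ i \<le> M ^ n" using that by (intro power_increasing) (auto simp: M_def)
      then have "norm ((f ^^ i) p - z) \<le> M ^ n * norm (p - z)"
        using iter[OF p(1), of i] mult_right_mono[of "M ^ i" "M ^ n" "norm (p - z)"] by simp
      also have "\<dots> < \<rho>" using p(3) Mn by (simp add: pos_less_divide_eq mult.commute)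
      finally have "norm ((f ^^ i) p - z) < \<rho>" .
      moreover have "(f ^^ i) p \<noteq> z"
        using fixn(1)[of i] p(2) bij_fn[OF Diff1D(4)[OF fD], of i] by (metis bij_is_inj injD)
      ultimately show ?thesis using U(4) fS[OF p(1)] by blast
    qed
    then have "n * \<delta> \<le> \<bar>\<Sum>i<n. \<Theta> z ((f ^^ i) p) c d\<bar>" by (rule sign)
    also have "quad z p c d" using S ne p by (auto simp: quad_def r_def norm_minus_commute)
    then have "\<bar>\<Sum>i<n. \<Theta> z ((f ^^ i) p) c d\<bar> \<le> C * l n" by (rule sumb)
    finally show ?thesis .
  qed
  have "(\<lambda>n. C * (real (l n) / real n)) \<longlonglongrightarrow> C * 0" by (intro tendsto_intros l)
  moreover have "\<forall>\<^sub>F n in sequentially. \<delta> \<le> C * (real (l n) / real n)"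
    using eventually_gt_at_top[of 0]
  proof eventually_elim
    case (elim n)
    then show ?case using main[of n] by (simp add: field_simps)
  qed
  ultimately have "\<delta> \<le> C * 0" by (intro tendsto_lowerbound) auto
  then show False using r0(2) by simp
qed

subsection \<open>Eigenvalues\<close>

lemma has_derivative_funpow_fixpoint:
  assumes D: "(f has_derivative L) (at z within S)" "f ` S \<subseteq> S" "f z = z"
  shows "((f ^^ n) has_derivative (L ^^ n)) (at z within S)"
proof (induction n)
  case 0
  show ?case by (simp add: id_def)
next
  case (Suc n)
  have "(f ^^ n) x \<in> S" if "x \<in> S" for x
    using that D(2) by (induction n) auto
  then have "(f ^^ n) ` S \<subseteq> S" by blast
  moreover have fz: "(f ^^ n) z = z" using D(3) by (induction n) auto
  ultimately have "(f has_derivative L) (at ((f ^^ n) z) within (f ^^ n) ` S)"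
    using has_derivative_subset[OF D(1)] by simp
  from has_derivative_in_compose[OF Suc.IH this] show ?case by (simp add: o_def)
qed

lemma derivative_bilipschitz:
  fixes F :: "pt \<Rightarrow> pt"
  assumes x: "x \<in> S2" and F: "(F has_derivative L) (at x within S2)" and v: "v \<in> tangent x"
    and lip: "\<And>y. y \<in> S2 \<Longrightarrow> norm (F y - F x) \<le> M * norm (y - x)"
      "\<And>y. y \<in> S2 \<Longrightarrow> norm (y - x) \<le> M * norm (F y - F x)"
  shows "norm (L v) \<le> M * norm v" "norm v \<le> M * norm (L v)"
proof -
  obtain \<gamma> where \<gamma>: "\<gamma> (0::real) = x" "\<And>t. \<gamma> t \<in> S2" "(\<gamma> has_vector_derivative v) (at 0)"
    using ex_curve[OF x v] by blast
  have d: "((\<lambda>t. F (\<gamma> t)) has_vector_derivative L v) (at 0)"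
    by (rule has_vector_derivative_along_curve[OF _ \<gamma>(2,3)]) (simp add: \<gamma>(1) F)
  show "norm (L v) \<le> M * norm v"
    by (rule derivative_bound_curve[OF \<gamma>(3) d]) (use lip(1)[OF \<gamma>(2)] \<gamma>(1) in simp)
  show "norm v \<le> M * norm (L v)"
    by (rule derivative_bound_curve[OF d \<gamma>(3)]) (use lip(2)[OF \<gamma>(2)] \<gamma>(1) in simp)
qed

text \<open>Logarithms give \<open>n * \<bar>ln x\<bar> \<le> l n * ln K\<close>; divide by
  \<open>n\<close>.\<close>

lemma subexponential_power_eq_1:
  fixes x K :: real
  assumes x: "x \<ge> 0" and K: "K \<ge> 1" and l: "(\<lambda>n. real (l n) / real n) \<longlonglongrightarrow> 0"
    and up: "\<And>n. x ^ n \<le> K ^ l n" and lo: "\<And>n. 1 \<le> K ^ l n * x ^ n"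
  shows "x = 1"
proof -
  have x0: "x > 0" using lo[of 1] x by (cases "x = 0") auto
  have K0: "K > 0" using K by simp
  have b: "\<bar>ln x\<bar> \<le> ln K * (real (l n) / real n)" if "n > 0" for n
  proof -
    have "ln (x ^ n) \<le> ln (K ^ l n)" using up[of n] x0 K0 by simp
    then have 1: "n * ln x \<le> l n * ln K" using x0 K0 by (simp add: ln_realpow)
    have "0 \<le> ln (K ^ l n * x ^ n)" using lo[of n] by simp
    then have 2: "0 \<le> l n * ln K + n * ln x" using x0 K0 by (simp add: ln_mult ln_realpow)
    have "n * \<bar>ln x\<bar> \<le> l n * ln K" using 1 2 by (cases "ln x \<ge> 0") auto
    then show ?thesis using that by (simp add: field_simps)
  qed
  have "(\<lambda>n. ln K * (real (l n) / real n)) \<longlonglongrightarrow> ln K * 0" by (intro tendsto_intros l)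
  moreover have "\<forall>\<^sub>F n in sequentially. \<bar>ln x\<bar> \<le> ln K * (real (l n) / real n)"
    using eventually_gt_at_top[of 0] by eventually_elim (rule b)
  ultimately have "\<bar>ln x\<bar> \<le> ln K * 0" by (intro tendsto_lowerbound) auto
  then show ?thesis using x0 by simp
qed

text \<open>The derivative of \<open>f ^^ n\<close> inherits the bi-Lipschitz constant
  \<open>K ^ l n\<close>. On a complex eigenvector \<open>u + iv\<close>, the quantity
  \<open>|u|^2 + |v|^2\<close> is multiplied by \<open>|\<mu>|^2\<close> at each step, which treats
  real and complex eigenvalues alike.\<close>

lemma distortion_eigenvalue_modulus:
  assumes dist: "distortion f" and z: "z \<in> S2" "f z = z" and ev: "tan_eigenvalue (sderiv f z) z \<mu>"
  shows "cmod \<mu> = 1"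
proof -
  have fD: "f \<in> Diff1" using dist Diff1_0_subset by (auto simp: distortion_def)
  let ?L = "sderiv f z"
  have D: "(f has_derivative ?L) (at z within S2)" by (rule sderiv[OF Diff1D(2)[OF fD] z(1)])
  have lin: "linear ?L" using D by (rule has_derivative_linear)
  obtain u v where uv: "u \<in> tangent z" "v \<in> tangent z" "u \<noteq> 0 \<or> v \<noteq> 0"
    "?L u = Re \<mu> *\<^sub>R u - Im \<mu> *\<^sub>R v" "?L v = Im \<mu> *\<^sub>R u + Re \<mu> *\<^sub>R v"
    using ev unfolding tan_eigenvalue_def by blast
  obtain C K :: real and l :: "nat \<Rightarrow> nat" where K: "K \<ge> 1" "(\<lambda>n. real (l n) / real n) \<longlonglongrightarrow> 0"
    "\<And>n x y. x \<in> S2 \<Longrightarrow> y \<in> S2 \<Longrightarrow> norm ((f ^^ n) x - (f ^^ n) y) \<le> K ^ l n * norm (x - y)"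
    "\<And>n x y. x \<in> S2 \<Longrightarrow> y \<in> S2 \<Longrightarrow> norm (x - y) \<le> K ^ l n * norm ((f ^^ n) x - (f ^^ n) y)"
    by (rule distortionE[OF dist]) blast
  have it: "(?L ^^ n) u = Re (\<mu> ^ n) *\<^sub>R u - Im (\<mu> ^ n) *\<^sub>R v \<and>
      (?L ^^ n) v = Im (\<mu> ^ n) *\<^sub>R u + Re (\<mu> ^ n) *\<^sub>R v" for n
  proof (induction n)
    case 0
    then show ?case by simp
  next
    case (Suc n)
    have "(?L ^^ Suc n) u = ?L ((?L ^^ n) u)" "(?L ^^ Suc n) v = ?L ((?L ^^ n) v)" by simp_all
    then show ?case
      unfolding conjunct1[OF Suc] conjunct2[OF Suc] linear_add[OF lin] linear_diff[OF lin] linear_scale[OF lin] uv(4,5)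
      by (simp add: algebra_simps)
  qed
  define N where "N = (norm u)\<^sup>2 + (norm v)\<^sup>2"
  have N: "N > 0" using uv(3) by (auto simp: N_def add_pos_nonneg add_nonneg_pos)
  have sq: "(norm ((?L ^^ n) u))\<^sup>2 + (norm ((?L ^^ n) v))\<^sup>2 = (cmod \<mu> ^ n)\<^sup>2 * N" for n
  proof -
    have m: "(cmod \<mu> ^ n)\<^sup>2 = (Re (\<mu> ^ n))\<^sup>2 + (Im (\<mu> ^ n))\<^sup>2"
      unfolding norm_power[of \<mu> n, symmetric] by (rule cmod_power2)
    show ?thesis
      unfolding conjunct1[OF it] conjunct2[OF it] m N_def power2_norm_eq_inner
      by (simp add: inner_add_left inner_add_right inner_diff_left inner_diff_right inner_commute
          power2_eq_square algebra_simps)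
  qed
  have bnd: "norm ((?L ^^ n) w) \<le> K ^ l n * norm w" "norm w \<le> K ^ l n * norm ((?L ^^ n) w)"
    if w: "w \<in> tangent z" for n w
  proof -
    note d = has_derivative_funpow_fixpoint[OF D Diff1D(3)[OF fD] z(2), of n]
    have lip: "norm ((f ^^ n) y - (f ^^ n) z) \<le> K ^ l n * norm (y - z)"
      "norm (y - z) \<le> K ^ l n * norm ((f ^^ n) y - (f ^^ n) z)" if "y \<in> S2" for y
      using K(3,4)[OF that z(1)] .
    show "norm ((?L ^^ n) w) \<le> K ^ l n * norm w" "norm w \<le> K ^ l n * norm ((?L ^^ n) w)"
      by (rule derivative_bilipschitz[OF z(1) d w lip]; assumption)+
  qed
  show ?thesis
  proof (rule subexponential_power_eq_1[OF norm_ge_zero K(1,2)])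
    fix n
    have K0: "0 \<le> K ^ l n" using K(1) by simp
    have "(norm ((?L ^^ n) u))\<^sup>2 + (norm ((?L ^^ n) v))\<^sup>2 \<le> (K ^ l n * norm u)\<^sup>2 + (K ^ l n * norm v)\<^sup>2"
      by (intro add_mono power_mono bnd uv) simp_all
    then have "(cmod \<mu> ^ n)\<^sup>2 * N \<le> (K ^ l n)\<^sup>2 * N"
      unfolding sq by (simp add: N_def power_mult_distrib distrib_left)
    then have "(cmod \<mu> ^ n)\<^sup>2 \<le> (K ^ l n)\<^sup>2" using N by simp
    then show "cmod \<mu> ^ n \<le> K ^ l n" using K0 by (rule power2_le_imp_le)
    have "(norm u)\<^sup>2 + (norm v)\<^sup>2 \<le> (K ^ l n * norm ((?L ^^ n) u))\<^sup>2 + (K ^ l n * norm ((?L ^^ n) v))\<^sup>2"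
      by (intro add_mono power_mono bnd uv) simp_all
    also have "\<dots> = (K ^ l n)\<^sup>2 * ((cmod \<mu> ^ n)\<^sup>2 * N)"
      unfolding sq[symmetric] by (simp add: power_mult_distrib distrib_left)
    finally have "1 * N \<le> (K ^ l n * cmod \<mu> ^ n)\<^sup>2 * N"
      by (simp add: N_def[symmetric] power_mult_distrib mult_ac)
    then have "1\<^sup>2 \<le> (K ^ l n * cmod \<mu> ^ n)\<^sup>2" using N by simp
    then show "1 \<le> K ^ l n * cmod \<mu> ^ n" by (rule power2_le_imp_le) (use K0 in simp)
  qed
qed

lemma tan_eigenvalue_cong:
  "(\<And>v. v \<in> tangent z \<Longrightarrow> L v = L' v) \<Longrightarrow> tan_eigenvalue L z \<mu> \<longleftrightarrow> tan_eigenvalue L' z \<mu>"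
  unfolding tan_eigenvalue_def by (metis (no_types, lifting))

lemma tan_eigenvalue_real:
  assumes "v \<in> tangent z" "v \<noteq> 0" "L v = s *\<^sub>R v" "L 0 = 0"
  shows "tan_eigenvalue L z (of_real s)"
  unfolding tan_eigenvalue_def
  by (rule exI[of _ v], rule exI[of _ 0]) (use assms in \<open>auto simp: tangent_def\<close>)

text \<open>With \<open>L v = v\<close> the matrix of \<open>L\<close> in the basis \<open>v\<close>, \<open>z \<times> v\<close> is triangular, and
  orientation makes the other diagonal entry positive.\<close>
lemma unimodular_eigenvalues_eq_1:
  assumes z: "z \<in> S2" and lin: "linear L" and tan: "\<And>v. v \<in> tangent z \<Longrightarrow> L v \<in> tangent z"
    and orient: "\<And>e1 e2. e1 \<in> tangent z \<Longrightarrow> e2 \<in> tangent z \<Longrightarrow> z \<bullet> (e1 \<times> e2) > 0 \<Longrightarrow>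
      z \<bullet> (L e1 \<times> L e2) > 0"
    and uni: "\<And>\<mu>. tan_eigenvalue L z \<mu> \<Longrightarrow> cmod \<mu> = 1"
    and v: "v \<in> tangent z" "v \<noteq> 0" "L v = v" and ev: "tan_eigenvalue L z \<mu>"
  shows "\<mu> = 1"
proof -
  define w where "w = z \<times> v"
  define n where "n = v \<bullet> v"
  have n: "n > 0" using v(2) by (simp add: n_def)
  have zz: "z \<bullet> z = 1" by (rule inner_S2_self[OF z])
  have vz: "v \<bullet> z = 0" "z \<bullet> v = 0" using v(1) by (auto simp: tangent_def inner_commute)
  have wz: "w \<bullet> z = 0" "z \<bullet> w = 0" "w \<bullet> v = 0" "v \<bullet> w = 0"
    by (auto simp: w_def dot_cross_self)
  have ww: "w \<bullet> w = n" by (simp add: w_def dot_cross zz vz n_def)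
  have wt: "w \<in> tangent z" using wz by (simp add: tangent_def)
  have vw: "v \<times> w = n *\<^sub>R z" by (simp add: w_def Lagrange vz n_def)
  have w0: "w \<noteq> 0" using ww n by auto
  have ex: "x = ((x \<bullet> v) / n) *\<^sub>R v + ((x \<bullet> w) / n) *\<^sub>R w" if x: "x \<in> tangent z" for x
  proof -
    define q where "q = x - (((x \<bullet> v) / n) *\<^sub>R v + ((x \<bullet> w) / n) *\<^sub>R w)"
    have q: "q \<bullet> v = 0" "q \<bullet> w = 0" "q \<bullet> z = 0"
      using x n ww wz vz by (auto simp: q_def inner_diff_left inner_add_left tangent_def n_def)
    have "q \<times> (z \<times> v) = 0" unfolding Lagrange using q by simp
    then have "q = 0" using norm_and_cross_eq_0[of q w] q w0 by (auto simp: w_def)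
    then show ?thesis unfolding q_def by (rule eq_iff_diff_eq_0[THEN iffD2])
  qed
  define c where "c = (L w \<bullet> v) / n"
  define d where "d = (L w \<bullet> w) / n"
  have Lw: "L w = c *\<^sub>R v + d *\<^sub>R w" unfolding c_def d_def by (rule ex[OF tan[OF wt]])
  have "z \<bullet> (v \<times> w) > 0" using n by (simp add: vw zz)
  then have "z \<bullet> (L v \<times> L w) > 0" by (rule orient[OF v(1) wt])
  then have "d * n > 0"
    by (simp add: v(3) Lw cross_add_right cross_mult_right cross_refl vw zz)
  then have d: "d > 0" using n by (simp add: zero_less_mult_iff)
  obtain a b where ab: "a \<in> tangent z" "b \<in> tangent z" "a \<noteq> 0 \<or> b \<noteq> 0"
    "L a = Re \<mu> *\<^sub>R a - Im \<mu> *\<^sub>R b" "L b = Im \<mu> *\<^sub>R a + Re \<mu> *\<^sub>R b"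
    using ev unfolding tan_eigenvalue_def by blast
  \<comment> \<open>Modulo the invariant line through \<open>v\<close>, the map is multiplication by
    \<open>d\<close>.\<close>
  have comp: "L x \<bullet> w = d * (x \<bullet> w)" if "x \<in> tangent z" for x
  proof -
    have "L x = ((x \<bullet> v) / n) *\<^sub>R L v + ((x \<bullet> w) / n) *\<^sub>R L w"
      using arg_cong[OF ex[OF that], of L] by (simp only: linear_add[OF lin] linear_scale[OF lin])
    then show ?thesis using n by (simp add: v(3) Lw inner_add_left wz ww)
  qed
  \<comment> \<open>The complex coordinate of \<open>a + ib\<close> along \<open>w\<close>, with
    \<open>\<mu> y = d y\<close>. Either \<open>\<mu>\<close> is \<open>d\<close>, positive and of
    modulus 1, or the eigenvector lies in the complex line spanned by \<open>v\<close>.\<close>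
  define y where "y = Complex (a \<bullet> w) (b \<bullet> w)"
  have e: "d * (a \<bullet> w) = Re \<mu> * (a \<bullet> w) - Im \<mu> * (b \<bullet> w)" "d * (b \<bullet> w) = Im \<mu> * (a \<bullet> w) + Re \<mu> * (b \<bullet> w)"
    using comp[OF ab(1)] comp[OF ab(2)] by (simp_all add: ab(4,5) inner_diff_left inner_add_left)
  then have "(\<mu> - of_real d) * y = 0"
    by (simp add: y_def complex_eq_iff algebra_simps)
  then consider "\<mu> = of_real d" | "y = 0" by auto
  then show ?thesis
  proof cases
    case 1
    then show ?thesis using uni[OF ev] d by simp
  next
    case 2
    then have 2: "a \<bullet> w = 0" "b \<bullet> w = 0" by (simp_all add: y_def complex_eq_iff)
    have La: "L x = x" if "x \<in> tangent z" "x \<bullet> w = 0" for x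
    proof -
      have x: "((x \<bullet> v) / n) *\<^sub>R v = x" using ex[OF that(1), symmetric] that(2) by simp
      then have "L x = L (((x \<bullet> v) / n) *\<^sub>R v)" by (simp only:)
      also have "\<dots> = ((x \<bullet> v) / n) *\<^sub>R v" by (simp only: linear_scale[OF lin] v(3))
      also have "\<dots> = x" by (rule x)
      finally show ?thesis .
    qed
    have "Re \<mu> *\<^sub>R a - Im \<mu> *\<^sub>R b = a" "Im \<mu> *\<^sub>R a + Re \<mu> *\<^sub>R b = b"
      using La[OF ab(1) 2(1)] La[OF ab(2) 2(2)] ab(4,5) by auto
    note eq = this
    define p where "p = Re \<mu> - 1"
    define q where "q = Im \<mu>"
    have pq: "p *\<^sub>R a = q *\<^sub>R b" "p *\<^sub>R b = - (q *\<^sub>R a)"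
      using arg_cong[OF eq(1), of "\<lambda>x. x - a + q *\<^sub>R b"] arg_cong[OF eq(2), of "\<lambda>x. x - b - q *\<^sub>R a"]
      by (simp_all add: p_def q_def scaleR_diff_left)
    \<comment> \<open>Multiplying \<open>(\<mu> - 1)(a + ib) = 0\<close> by the conjugate of
      \<open>\<mu> - 1\<close> separates \<open>a\<close> from \<open>b\<close>.\<close>
    have "(p * p + q * q) *\<^sub>R a = p *\<^sub>R (p *\<^sub>R a) + q *\<^sub>R (q *\<^sub>R a)"
      by (simp add: scaleR_add_left)
    also have "p *\<^sub>R (p *\<^sub>R a) = q *\<^sub>R (p *\<^sub>R b)" unfolding pq(1) by (simp add: mult.commute)
    finally have 1: "(p * p + q * q) *\<^sub>R a = 0" unfolding pq(2) by simp
    have "(p * p + q * q) *\<^sub>R b = p *\<^sub>R (p *\<^sub>R b) + q *\<^sub>R (q *\<^sub>R b)"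
      by (simp add: scaleR_add_left)
    also have "p *\<^sub>R (p *\<^sub>R b) = - (q *\<^sub>R (p *\<^sub>R a))" unfolding pq(2) by (simp add: mult.commute)
    finally have 2: "(p * p + q * q) *\<^sub>R b = 0" unfolding pq(1) by simp
    have "p * p + q * q = 0" using 1 2 ab(3) by (metis scaleR_eq_0_iff)
    then have "p = 0" "q = 0" by (simp_all add: sum_squares_eq_zero_iff)
    then show ?thesis by (simp add: p_def q_def complex_eq_iff)
  qed
qed

theorem theoremB:
  fixes f :: "real^3 \<Rightarrow> real^3"
  assumes "distortion f"
    and "\<exists>a b c. a \<in> S2 \<and> b \<in> S2 \<and> c \<in> S2 \<and> f a = a \<and> f b = b \<and> f c = c \<and>
                 a \<noteq> b \<and> a \<noteq> c \<and> b \<noteq> c"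
  shows "\<forall>z\<in>S2. f z = z \<longrightarrow> (\<forall>\<mu>::complex. tan_eigenvalue (tderiv f z) z \<mu> \<longleftrightarrow> \<mu> = 1)"
proof (intro ballI impI allI)
  fix z \<mu> assume z: "z \<in> S2" "f z = z"
  have f0: "f \<in> Diff1_0" using assms(1) by (simp add: distortion_def)
  then have fD: "f \<in> Diff1" using Diff1_0_subset by blast
  let ?L = "sderiv f z"
  have D: "(f has_derivative ?L) (at z within S2)" by (rule sderiv[OF Diff1D(2)[OF fD] z(1)])
  have lin: "linear ?L" using D by (rule has_derivative_linear)
  have cong: "tan_eigenvalue (tderiv f z) z \<mu> \<longleftrightarrow> tan_eigenvalue ?L z \<mu>" for \<mu>
    by (rule tan_eigenvalue_cong) (rule tderiv_tangent)
  have uni: "cmod \<mu> = 1" if "tan_eigenvalue ?L z \<mu>" for \<mu>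
    by (rule distortion_eigenvalue_modulus[OF assms(1) z that])
  \<comment> \<open>At most one of the three given fixed points equals \<open>z\<close>, so two
    others remain.\<close>
  obtain c d where cd: "c \<in> S2" "d \<in> S2" "z \<noteq> c" "c \<noteq> d" "d \<noteq> z" "f c = c" "f d = d"
  proof -
    obtain a b c where "a \<in> S2" "b \<in> S2" "c \<in> S2" "f a = a" "f b = b" "f c = c" "a \<noteq> b" "a \<noteq> c" "b \<noteq> c"
      using assms(2) by blast
    then show thesis using that[of a b] that[of a c] that[of b c] by blast
  qed
  obtain v s where v: "v \<in> tangent z" "v \<noteq> 0" "s \<ge> 0" "?L v = s *\<^sub>R v"
    using distortion_nonneg_eigenvector[OF assms(1) z(1) cd(1-5) z(2) cd(6,7)] by blast
  have es: "tan_eigenvalue ?L z (of_real s)"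
    by (rule tan_eigenvalue_real[of _ _ _ s, OF v(1,2,4) linear_0[OF lin]])
  \<comment> \<open>The sign of \<open>s\<close> is decisive: modulus 1 alone would leave the
    eigenvalue \<open>-1\<close>.\<close>
  have s1: "s = 1" using uni[OF es] v(3) by simp
  show "tan_eigenvalue (tderiv f z) z \<mu> \<longleftrightarrow> \<mu> = 1"
    unfolding cong
  proof
    assume "\<mu> = 1"
    then show "tan_eigenvalue ?L z \<mu>" using es s1 by simp
  next
    have tan: "?L w \<in> tangent z" if "w \<in> tangent z" for w
      using derivative_tangent[OF z(1) D Diff1D(3)[OF fD] that] unfolding z(2) .
    have orient: "z \<bullet> (?L e1 \<times> ?L e2) > 0"
      if "e1 \<in> tangent z" "e2 \<in> tangent z" "z \<bullet> (e1 \<times> e2) > 0" for e1 e2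
      using Diff1_0_orientation[OF f0 z(1) that] unfolding z(2) .
    have Lv: "?L v = v" using v(4) unfolding s1 by simp
    assume "tan_eigenvalue ?L z \<mu>"
    with unimodular_eigenvalues_eq_1[OF z(1) lin tan orient uni v(1,2) Lv]
    show "\<mu> = 1" by blast
  qed
qed

end
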